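(* Let $P$ be a program and suppose $\mathrm{EGD}(\mathbf{P},\boldsymbol\alpha)\mathrel{[\![P]\!]^{\mathsf{geo}}}\mathrm{EGD}(\mathbf{Q},\boldsymbol\beta)$ for some EGDs. Then the running time $T$ of $P$ on $\mathrm{EGD}(\mathbf{P},\boldsymbol\alpha)$ can be bounded by an EGD as well: there is a one-dimensional EGD $\mathrm{EGD}(\mathbf{U},\tau)$ such that the distribution of $T$ is $\preceq\mathrm{EGD}(\mathbf{U},\tau)$. In particular, all moments $\mathbb{E}[T^k]$, $k\in\mathbb{N}$, are finite.
   Context: Running time. Given a program $P$ over $X_1,\dots,X_n$, introduce a fresh variable $T:=X_{n+1}$ and let $P^T$ be the program over $X_1,\dots,X_{n+1}$ obtained by adding $T\mathrel{+}=1$ after each statement: $S^T:=(S;\,T\mathrel{+}=1)$ for the simple statements $S$ ($\mathsf{skip}$, $X_k:=0$, $X_k\mathrel{+}=a$, $X_k\mathrel{\dot-}=1$, $\mathsf{fail}$), $(P_1;P_2)^T:=P_1^T;P_2^T$, $(\mathsf{if}\ E\ \{P_1\}\ \mathsf{else}\ \{P_2\})^T:=\mathsf{if}\ E\ \{P_1^T\}\ \mathsf{else}\ \{P_2^T\}$, $(\mathsf{while}\ E\ \{P_1\})^T:=\mathsf{while}\ E\ \{P_1^T\}$. The distribution of the running time $T$ of $P$ on a measure $\mu$ on $\mathbb{N}^n$ is the marginal on the last coordinate of $[\![P^T]\!](\mu\otimes\mathrm{Dirac}(0))$, a measure on $\mathbb{N}$, and $\mathbb{E}[T^k]$ is the sum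 of $t^k$ weighted by its masses. Language. Fix $n$ variables $X_1,\dots,X_n$ with values in $\mathbb{N}=\{0,1,2,\dots\}$. Programs $P$ and events $E$ are given by $P ::= \mathsf{skip} \mid P_1;P_2 \mid X_k := 0 \mid X_k \mathrel{+}= a \mid X_k \mathrel{\dot-}= 1 \mid \mathsf{if}\ E\ \{P_1\}\ \mathsf{else}\ \{P_2\} \mid \mathsf{while}\ E\ \{P_1\} \mid \mathsf{fail}$ and $E ::= X_k = a \mid \mathsf{flip}(\rho) \mid \lnot E_1 \mid E_1 \land E_2$, with literals $a \in \mathbb{N}$, $\rho \in [0,1]$. (All definitions below are used for $n$ and also for $n+1$ variables.) State space. $\mathbb{N}^n_\dagger := \mathbb{N}^n \cup \{\dagger\}$ where $\dagger$ is a failure state; all $\sigma$-algebras are discrete. For measures, $\mu \preceq \nu$ means $\mu(S)\le\nu(S)$ for all $S$; for measure transformers, $\phi \sqsubseteq \psi$ means $\phi(\mu)\preceq\psi(\mu)$ for all $\mu$. Write $\mu|_\dagger$ and $\mu|_{\mathbb{N}^n}$ for the restrictions of $\mu$ to $\{\dagger\}$ and $\mathbb{N}^n$; $\boldsymbol{x}[k\mapsto v]$ is $\boldsymbol{x}$ with $k$-th entry replaced by $v$; $x \mathbin{\dot-} 1 := \max(x-1,0)$. Measures on $\mathbb{N}^n$ are regarded as measures on $\mathbb{N}^n_\dagger$ with no mass on $\dagger$. Event semantics. $\mu|_{X_k=a}(S) := \mu(\{\boldsymbol{x}\in S\cap\mathbb{N}^n : x_k=a\})$, $\mu|_{\mathsf{flip}(\rho)}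 := \rho\cdot\mu|_{\mathbb{N}^n}$, $\mu|_{\lnot E_1} := \mu|_{\mathbb{N}^n}-\mu|_{E_1}$, $\mu|_{E_1\land E_2} := (\mu|_{E_1})|_{E_2}$. Standard semantics $[\![P]\!]_\dagger : \mathrm{Meas}(\mathbb{N}^n_\dagger)\to\mathrm{Meas}(\mathbb{N}^n_\dagger)$: $[\![\mathsf{skip}]\!]_\dagger(\mu)=\mu$; $[\![P_1;P_2]\!]_\dagger(\mu)=[\![P_2]\!]_\dagger([\![P_1]\!]_\dagger(\mu))$; $[\![X_k:=0]\!]_\dagger(\mu)(S)=\mu|_\dagger(S)+\mu(\{\boldsymbol{x}\in\mathbb{N}^n : \boldsymbol{x}[k\mapsto 0]\in S\})$; $[\![X_k \mathrel{+}= a]\!]_\dagger(\mu)(S)=\mu|_\dagger(S)+\mu(\{\boldsymbol{x}\in\mathbb{N}^n : \boldsymbol{x}[k\mapsto x_k+a]\in S\})$; $[\![X_k \mathrel{\dot-}= 1]\!]_\dagger(\mu)(S)=\mu|_\dagger(S)+\mu(\{\boldsymbol{x}\in\mathbb{N}^n : \boldsymbol{x}[k\mapsto x_k\mathbin{\dot-}1]\in S\})$; $[\![\mathsf{if}\ E\ \{P_1\}\ \mathsf{else}\ \{P_2\}]\!]_\dagger(\mu)=\mu|_\dagger+[\![P_1]\!]_\dagger(\mu|_E)+[\![P_2]\!]_\dagger(\mu|_{\lnot E})$; $[\![\mathsf{fail}]\!]_\dagger(\mu)=\mu(\mathbb{N}^n_\dagger)\cdot\mathrm{Dirac}(\dagger)$;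 $[\![\mathsf{while}\ E\ \{P_1\}]\!]_\dagger$ is the least fixed point (w.r.t. $\sqsubseteq$) of $\Phi_{E,P_1}(\psi)(\mu) := \mu|_\dagger+\mu|_{\lnot E}+\psi([\![P_1]\!]_\dagger(\mu|_E))$. Simplified semantics: $[\![P]\!](\mu) := [\![P]\!]_\dagger(\mu)|_{\mathbb{N}^n}$ for $\mu\in\mathrm{Meas}(\mathbb{N}^n)$. Tensors and EGDs. $[d] := \{0,\dots,d-1\}$. A tensor $\mathbf{T}\in\mathbb{R}^{[d_1]\times\cdots\times[d_n]}$ (all $d_i\ge1$) has size $|\mathbf{T}|=(d_1,\dots,d_n)$, $|\mathbf{T}|_i=d_i$; $\mathbf{T}_{k:j}$ is the slice with $k$-th index fixed to $j$. Operations $\min,\max,+,-$ and relations $\le,<$ on vectors are componentwise; $\mathbf{0}_n,\mathbf{1}_n$ are the constant vectors; $\boldsymbol\alpha^{\boldsymbol i} := \prod_k\alpha_k^{i_k}$ with $0^0=1$; $[\varphi]$ is $1$ if $\varphi$ holds and $0$ otherwise. For a nonnegative tensor $\mathbf{P}$ and $\boldsymbol\alpha\in[0,1)^n$, $\mathrm{EGD}(\mathbf{P},\boldsymbol\alpha)$ is the measure on $\mathbb{N}^n$ with mass function $\boldsymbol i\mapsto\mathbf{P}_{\min(\boldsymbol i,|\mathbf{P}|-\mathbf{1}_n)}\cdot\boldsymbol\alpha^{\max(\boldsymbol i-|\mathbf{P}|+\mathbf{1}_n,\mathbf{0}_n)}$. An expansion of $\mathrm{EGD}(\mathbf{P},\boldsymbol\alpha)$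 to a size $\boldsymbol s\ge|\mathbf{P}|$ is $\mathrm{EGD}(\mathbf{P}',\boldsymbol\alpha)$ with $|\mathbf{P}'|=\boldsymbol s$ and $\mathbf{P}'_{\boldsymbol i}=\mathbf{P}_{\min(\boldsymbol i,|\mathbf{P}|-\mathbf{1}_n)}\boldsymbol\alpha^{\max(\boldsymbol i-|\mathbf{P}|+\mathbf{1}_n,\mathbf{0}_n)}$ for $\boldsymbol i<\boldsymbol s$. The relations and operations below act on representations $(\mathbf{P},\boldsymbol\alpha)$, although written with $\mathrm{EGD}(\mathbf{P},\boldsymbol\alpha)$. Order: $\mathrm{EGD}(\mathbf{P},\boldsymbol\alpha)\preceq_{\mathsf{EGD}}\mathrm{EGD}(\mathbf{Q},\boldsymbol\beta)$ iff $\boldsymbol\alpha\le\boldsymbol\beta$ and for all $\boldsymbol i<\max(|\mathbf{P}|,|\mathbf{Q}|)$: $\mathbf{P}_{\min(\boldsymbol i,|\mathbf{P}|-\mathbf{1}_n)}\boldsymbol\alpha^{\max(\boldsymbol i-|\mathbf{P}|+\mathbf{1}_n,\mathbf{0}_n)}\le\mathbf{Q}_{\min(\boldsymbol i,|\mathbf{Q}|-\mathbf{1}_n)}\boldsymbol\beta^{\max(\boldsymbol i-|\mathbf{Q}|+\mathbf{1}_n,\mathbf{0}_n)}$. Join: $(\mathrm{EGD}(\mathbf{R},\boldsymbol\gamma),\mathrm{EGD}(\mathbf{S},\boldsymbol\delta),\mathrm{EGD}(\mathbf{Q},\boldsymbol\beta))\in\mathsf{Join}$ iff $\boldsymbol\gamma\le\boldsymbol\beta$,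 $\boldsymbol\delta\le\boldsymbol\beta$ and there are expansions $\mathrm{EGD}(\mathbf{R}',\boldsymbol\gamma)$, $\mathrm{EGD}(\mathbf{S}',\boldsymbol\delta)$ of the first two, of the same size, with $\mathbf{Q}=\mathbf{R}'+\mathbf{S}'$. Geometric event semantics $\mathrm{EGD}(\mathbf{P},\boldsymbol\alpha)|^{\mathsf{geo}}_E$: for $X_k=a$: $\mathrm{EGD}(\mathbf{Q},\boldsymbol\alpha[k\mapsto0])$ with $|\mathbf{Q}|=|\mathbf{P}|[k\mapsto\max(|\mathbf{P}|_k,a+2)]$, $\mathbf{Q}_{k:j}=\mathbf{P}_{k:\min(j,|\mathbf{P}|_k-1)}\cdot\alpha_k^{\max(0,j-|\mathbf{P}|_k+1)}\cdot[j=a]$; for $\mathsf{flip}(\rho)$: $\mathrm{EGD}(\rho\mathbf{P},\boldsymbol\alpha)$; for $\lnot E_1$: $\mathrm{EGD}(\mathbf{Q},\boldsymbol\alpha)$ where $\mathrm{EGD}(\mathbf{P},\boldsymbol\alpha)|^{\mathsf{geo}}_{E_1}=\mathrm{EGD}(\mathbf{R},\boldsymbol\gamma)$, $|\mathbf{Q}|=|\mathbf{R}|$, $\mathbf{Q}_{\boldsymbol i}=\mathbf{P}_{\min(\boldsymbol i,|\mathbf{P}|-\mathbf{1}_n)}\boldsymbol\alpha^{\max(\boldsymbol i-|\mathbf{P}|+\mathbf{1}_n,\mathbf{0}_n)}-\mathbf{R}_{\boldsymbol i}$ for $\boldsymbol i<|\mathbf{Q}|$; for $E_1\land E_2$: $(\mathrm{EGD}(\mathbf{P},\boldsymbol\alpha)|^{\mathsf{geo}}_{E_1})|^{\mathsf{geo}}_{E_2}$.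 Geometric bound semantics: the relation $\mathrm{EGD}(\mathbf{P},\boldsymbol\alpha)\mathrel{[\![P]\!]^{\mathsf{geo}}}\mathrm{EGD}(\mathbf{Q},\boldsymbol\beta)$ holds iff: - $\mathsf{skip}$: $\boldsymbol\beta=\boldsymbol\alpha$, $\mathbf{Q}=\mathbf{P}$. - $P_1;P_2$: there are $\mathbf{R},\boldsymbol\gamma$ with $\mathrm{EGD}(\mathbf{P},\boldsymbol\alpha)\mathrel{[\![P_1]\!]^{\mathsf{geo}}}\mathrm{EGD}(\mathbf{R},\boldsymbol\gamma)$ and $\mathrm{EGD}(\mathbf{R},\boldsymbol\gamma)\mathrel{[\![P_2]\!]^{\mathsf{geo}}}\mathrm{EGD}(\mathbf{Q},\boldsymbol\beta)$. - $X_k:=0$: $\boldsymbol\beta=\boldsymbol\alpha[k\mapsto0]$, $|\mathbf{Q}|=|\mathbf{P}|[k\mapsto2]$, $\mathbf{Q}_{k:0}=\frac{\mathbf{P}_{k:|\mathbf{P}|_k-1}}{1-\alpha_k}+\sum_{j=0}^{|\mathbf{P}|_k-2}\mathbf{P}_{k:j}$, $\mathbf{Q}_{k:1}=0$. - $X_k\mathrel{+}=a$: $\boldsymbol\beta=\boldsymbol\alpha$, $|\mathbf{Q}|=|\mathbf{P}|[k\mapsto|\mathbf{P}|_k+a]$, $\mathbf{Q}_{k:j}=0$ for $j<a$ and $\mathbf{Q}_{k:j}=\mathbf{P}_{k:j-a}$ otherwise. - $X_k\mathrel{\dot-}=1$: $\boldsymbol\beta=\boldsymbol\alpha$, $|\mathbf{Q}|=|\mathbf{P}|[k\mapsto\max(|\mathbf{P}|_k-1,2)]$,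 $\mathbf{Q}_{k:0}=\mathbf{P}_{k:0}+\mathbf{P}_{k:\min(|\mathbf{P}|_k-1,1)}\alpha_k^{\max(2-|\mathbf{P}|_k,0)}$ and $\mathbf{Q}_{k:j}=\mathbf{P}_{k:\min(|\mathbf{P}|_k-1,j+1)}\alpha_k^{\max(j+2-|\mathbf{P}|_k,0)}$ for $j\ge1$. - $\mathsf{if}\ E\ \{P_1\}\ \mathsf{else}\ \{P_2\}$: there are $\mathbf{R},\mathbf{S},\boldsymbol\gamma,\boldsymbol\delta$ with $\mathrm{EGD}(\mathbf{P},\boldsymbol\alpha)|^{\mathsf{geo}}_E\mathrel{[\![P_1]\!]^{\mathsf{geo}}}\mathrm{EGD}(\mathbf{R},\boldsymbol\gamma)$, $\mathrm{EGD}(\mathbf{P},\boldsymbol\alpha)|^{\mathsf{geo}}_{\lnot E}\mathrel{[\![P_2]\!]^{\mathsf{geo}}}\mathrm{EGD}(\mathbf{S},\boldsymbol\delta)$ and $(\mathrm{EGD}(\mathbf{R},\boldsymbol\gamma),\mathrm{EGD}(\mathbf{S},\boldsymbol\delta),\mathrm{EGD}(\mathbf{Q},\boldsymbol\beta))\in\mathsf{Join}$. - $\mathsf{while}\ E\ \{B\}$: there are $c\in[0,1)$, $\mathbf{R},\mathbf{S},\boldsymbol\gamma,\boldsymbol\delta$ with $\mathrm{EGD}(\mathbf{P},\boldsymbol\alpha)\preceq_{\mathsf{EGD}}\mathrm{EGD}(\mathbf{R},\boldsymbol\gamma)$, $\mathrm{EGD}(\mathbf{R},\boldsymbol\gamma)|^{\mathsf{geo}}_E\mathrel{[\![B]\!]^{\mathsf{geo}}}\mathrm{EGD}(\mathbf{S},\boldsymbol\delta)$,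 $\mathrm{EGD}(\mathbf{S},\boldsymbol\delta)\preceq_{\mathsf{EGD}}\mathrm{EGD}(c\,\mathbf{R},\boldsymbol\gamma)$ and $\mathrm{EGD}(\frac{\mathbf{R}}{1-c},\boldsymbol\gamma)|^{\mathsf{geo}}_{\lnot E}=\mathrm{EGD}(\mathbf{Q},\boldsymbol\beta)$. - $\mathsf{fail}$: $\boldsymbol\beta=\mathbf{0}_n$, $\mathbf{Q}$ is the zero tensor of size $(1,\dots,1)$. *)

theory Defs
  imports "HOL-Probability.Probability"
begin

text \<open>
  Variables, and all vector coordinates, are numbered from 0: the variable written $X_{k+1}$ on
  paper is variable \<open>k\<close> here, and vectors of length \<open>n\<close> are lists of length \<open>n\<close>. The number \<open>n\<close>
  of variables is an explicit parameter because it changes from \<open>n\<close> to \<open>n + 1\<close>.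
\<close>

section \<open>Syntax\<close>

datatype event =
    VarEq nat nat
  | Flip real
  | Neg event
  | Conj event event

datatype prog =
    Skip
  | Seq prog prog
  | SetZero nat
  | Incr nat nat
  | Decr nat
  | If event prog prog
  | While event prog
  | Fail

primrec wf_event :: "nat \<Rightarrow> event \<Rightarrow> bool" where
  "wf_event n (VarEq k a) \<longleftrightarrow> k < n"
| "wf_event n (Flip \<rho>) \<longleftrightarrow> 0 \<le> \<rho> \<and> \<rho> \<le> 1"
| "wf_event n (Neg E) \<longleftrightarrow> wf_event n E"
| "wf_event n (Conj E1 E2) \<longleftrightarrow> wf_event n E1 \<and> wf_event n E2"

primrec wf_prog :: "nat \<Rightarrow> prog \<Rightarrow> bool" where
  "wf_prog n Skip \<longleftrightarrow> True"
| "wf_prog n (Seq P1 P2) \<longleftrightarrow> wf_prog n P1 \<and> wf_prog n P2"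
| "wf_prog n (SetZero k) \<longleftrightarrow> k < n"
| "wf_prog n (Incr k a) \<longleftrightarrow> k < n"
| "wf_prog n (Decr k) \<longleftrightarrow> k < n"
| "wf_prog n (If E P1 P2) \<longleftrightarrow> wf_event n E \<and> wf_prog n P1 \<and> wf_prog n P2"
| "wf_prog n (While E B) \<longleftrightarrow> wf_event n E \<and> wf_prog n B"
| "wf_prog n Fail \<longleftrightarrow> True"

text \<open>The fresh variable $T$ of a program over \<open>n\<close> variables has number \<open>n\<close>.\<close>

primrec timed :: "nat \<Rightarrow> prog \<Rightarrow> prog" where
  "timed n Skip = Seq Skip (Incr n 1)"
| "timed n (Seq P1 P2) = Seq (timed n P1) (timed n P2)"
| "timed n (SetZero k) = Seq (SetZero k) (Incr n 1)"
| "timed n (Incr k a) = Seq (Incr k a) (Incr n 1)"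
| "timed n (Decr k) = Seq (Decr k) (Incr n 1)"
| "timed n (If E P1 P2) = If E (timed n P1) (timed n P2)"
| "timed n (While E B) = While E (timed n B)"
| "timed n Fail = Seq Fail (Incr n 1)"

section \<open>Measure semantics\<close>

definition vecs :: "nat \<Rightarrow> nat list set" where
  "vecs n = {x. length x = n}"

text \<open>\<open>None\<close> is the failure state.\<close>

definition states :: "nat \<Rightarrow> nat list option set" where
  "states n = insert None (Some ` vecs n)"

definition Meas :: "nat \<Rightarrow> nat list option measure set" where
  "Meas n = {\<mu>. sets \<mu> = sets (count_space (states n))}"

abbreviation mk_meas :: "nat \<Rightarrow> (nat list option set \<Rightarrow> ennreal) \<Rightarrow> nat list option measure" where
  "mk_meas n f \<equiv> measure_of (states n) (Pow (states n)) f"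

definition meas_le :: "'a measure \<Rightarrow> 'a measure \<Rightarrow> bool" (infix "\<preceq>" 50) where
  "\<mu> \<preceq> \<nu> \<longleftrightarrow> sets \<mu> = sets \<nu> \<and> (\<forall>S\<in>sets \<mu>. emeasure \<mu> S \<le> emeasure \<nu> S)"

text \<open>
  The difference in the clause for \<open>Neg\<close> is meaningful for finite measures; for infinite ones
  it may be a junk measure, which no program reaches from a finite initial measure.
\<close>

primrec restr :: "nat \<Rightarrow> event \<Rightarrow> nat list option measure \<Rightarrow> nat list option measure" where
  "restr n (VarEq k a) \<mu> = mk_meas n (\<lambda>S. emeasure \<mu> {s \<in> S. \<exists>x\<in>vecs n. s = Some x \<and> x ! k = a})"
| "restr n (Flip \<rho>) \<mu> = mk_meas n (\<lambda>S. ennreal \<rho> * emeasure \<mu> (S \<inter> Some ` vecs n))"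
| "restr n (Neg E) \<mu> =
     mk_meas n (\<lambda>S. emeasure \<mu> (S \<inter> Some ` vecs n) - emeasure (restr n E \<mu>) S)"
| "restr n (Conj E1 E2) \<mu> = restr n E2 (restr n E1 \<mu>)"

text \<open>
  Transformers are extensional functions on \<open>Meas n\<close>, so that a least fixed point is unique as
  a HOL function. For a loop it exists: its operator is monotone and \<open>\<omega>\<close>-continuous in \<open>\<psi>\<close>.
\<close>

definition is_least_fp ::
  "nat \<Rightarrow> ((nat list option measure \<Rightarrow> nat list option measure)
          \<Rightarrow> nat list option measure \<Rightarrow> nat list option measure)
   \<Rightarrow> (nat list option measure \<Rightarrow> nat list option measure) \<Rightarrow> bool" where
  "is_least_fp n \<Phi> \<psi> \<longleftrightarrow>
     \<psi> \<in> Meas n \<rightarrow>\<^sub>E Meas n \<and>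
     (\<forall>\<mu>\<in>Meas n. \<Phi> \<psi> \<mu> = \<psi> \<mu>) \<and>
     (\<forall>\<psi>' \<in> Meas n \<rightarrow>\<^sub>E Meas n. (\<forall>\<mu>\<in>Meas n. \<Phi> \<psi>' \<mu> = \<psi>' \<mu>) \<longrightarrow> (\<forall>\<mu>\<in>Meas n. \<psi> \<mu> \<preceq> \<psi>' \<mu>))"

definition update_sem ::
  "nat \<Rightarrow> (nat list \<Rightarrow> nat list) \<Rightarrow> nat list option measure \<Rightarrow> nat list option measure" where
  "update_sem n f \<mu> =
     mk_meas n (\<lambda>S. emeasure \<mu> (S \<inter> {None}) + emeasure \<mu> {Some x | x. x \<in> vecs n \<and> Some (f x) \<in> S})"

primrec sem :: "nat \<Rightarrow> prog \<Rightarrow> nat list option measure \<Rightarrow> nat list option measure" where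
  "sem n Skip = (\<lambda>\<mu>. \<mu>)"
| "sem n (Seq P1 P2) = (\<lambda>\<mu>. sem n P2 (sem n P1 \<mu>))"
| "sem n (SetZero k) = update_sem n (\<lambda>x. x[k := 0])"
| "sem n (Incr k a) = update_sem n (\<lambda>x. x[k := x ! k + a])"
| "sem n (Decr k) = update_sem n (\<lambda>x. x[k := x ! k - 1])"
| "sem n (If E P1 P2) = (\<lambda>\<mu>. mk_meas n (\<lambda>S.
     emeasure \<mu> (S \<inter> {None}) + emeasure (sem n P1 (restr n E \<mu>)) S
       + emeasure (sem n P2 (restr n (Neg E) \<mu>)) S))"
| "sem n (While E B) = (THE \<psi>. is_least_fp n (\<lambda>\<psi> \<mu>. mk_meas n (\<lambda>S.
     emeasure \<mu> (S \<inter> {None}) + emeasure (restr n (Neg E) \<mu>) S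
       + emeasure (\<psi> (sem n B (restr n E \<mu>))) S)) \<psi>)"
| "sem n Fail = (\<lambda>\<mu>. mk_meas n (\<lambda>S. emeasure \<mu> (states n) * indicator S None))"

text \<open>The simplified semantics, on measures on \<open>vecs n\<close>.\<close>

definition sem_proper :: "nat \<Rightarrow> prog \<Rightarrow> nat list measure \<Rightarrow> nat list measure" where
  "sem_proper n P \<mu> = measure_of (vecs n) (Pow (vecs n))
     (\<lambda>S. emeasure (sem n P (distr \<mu> (count_space (states n)) Some)) (Some ` S))"

definition running_time :: "nat \<Rightarrow> prog \<Rightarrow> nat list measure \<Rightarrow> nat measure" where
  "running_time n P \<mu> =
     distr
       (sem_proper (n + 1) (timed n P)
         (distr (\<mu> \<Otimes>\<^sub>M return (count_space UNIV) 0) (count_space (vecs (n + 1))) (\<lambda>(x, t). x @ [t])))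
       (count_space UNIV) (\<lambda>x. x ! n)"

definition moment :: "nat \<Rightarrow> nat measure \<Rightarrow> ennreal" where
  "moment k M = (\<Sum>t. of_nat (t ^ k) * emeasure M {t})"

section \<open>Tensors and eventually geometric distributions\<close>

text \<open>
  A tensor consists of its size and its entries. Entries outside the index range are normalised
  to \<open>undefined\<close> (as for \<open>extensional\<close> functions), so that HOL equality is equality of tensors.
\<close>

datatype tensor = Tensor (dims: "nat list") (entry: "nat list \<Rightarrow> real")

definition box :: "nat list \<Rightarrow> nat list set" where
  "box d = {i. list_all2 (<) i d}"

definition mk_tensor :: "nat list \<Rightarrow> (nat list \<Rightarrow> real) \<Rightarrow> tensor" where
  "mk_tensor d f = Tensor d (restrict f (box d))"

definition nonneg_tensor :: "nat \<Rightarrow> tensor \<Rightarrow> bool" where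
  "nonneg_tensor n P \<longleftrightarrow> length (dims P) = n \<and> (\<forall>d\<in>set (dims P). 1 \<le> d) \<and>
     entry P \<in> extensional (box (dims P)) \<and> (\<forall>i\<in>box (dims P). 0 \<le> entry P i)"

definition scale_tensor :: "real \<Rightarrow> tensor \<Rightarrow> tensor" where
  "scale_tensor c P = mk_tensor (dims P) (\<lambda>i. c * entry P i)"

definition add_tensor :: "tensor \<Rightarrow> tensor \<Rightarrow> tensor" where
  "add_tensor P Q = mk_tensor (dims P) (\<lambda>i. entry P i + entry Q i)"

definition vec_power :: "real list \<Rightarrow> nat list \<Rightarrow> real" where
  "vec_power \<alpha> i = prod_list (map2 (^) \<alpha> i)"

text \<open>Representations of EGDs: a tensor together with its decay rates.\<close>

type_synonym egd = "tensor \<times> real list"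

definition is_egd :: "nat \<Rightarrow> egd \<Rightarrow> bool" where
  "is_egd n = (\<lambda>(P, \<alpha>). nonneg_tensor n P \<and> length \<alpha> = n \<and> (\<forall>a\<in>set \<alpha>. 0 \<le> a \<and> a < 1))"

text \<open>
  The mass at an arbitrary index. Since \<open>1 \<le> d\<close>, the truncated difference \<open>j + 1 - d\<close> on
  naturals is $\max(j - d + 1, 0)$; this convention is used throughout.
\<close>

definition coeff_at :: "egd \<Rightarrow> nat list \<Rightarrow> real" where
  "coeff_at = (\<lambda>(P, \<alpha>) i.
     entry P (map2 (\<lambda>j d. min j (d - 1)) i (dims P))
       * vec_power \<alpha> (map2 (\<lambda>j d. j + 1 - d) i (dims P)))"

definition EGD :: "nat \<Rightarrow> egd \<Rightarrow> nat list measure" where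
  "EGD n A = point_measure (vecs n) (\<lambda>i. ennreal (coeff_at A i))"

text \<open>A one-dimensional EGD as a measure on the naturals, identifying \<open>vecs 1\<close> with \<open>nat\<close>.\<close>

definition EGD1 :: "tensor \<Rightarrow> real \<Rightarrow> nat measure" where
  "EGD1 U \<tau> = distr (EGD 1 (U, [\<tau>])) (count_space UNIV) hd"

definition expand :: "nat list \<Rightarrow> egd \<Rightarrow> tensor" where
  "expand s A = mk_tensor s (coeff_at A)"

definition egd_le :: "egd \<Rightarrow> egd \<Rightarrow> bool" where
  "egd_le = (\<lambda>(P, \<alpha>) (Q, \<beta>). list_all2 (\<le>) \<alpha> \<beta> \<and>
     (\<forall>i\<in>box (map2 max (dims P) (dims Q)). coeff_at (P, \<alpha>) i \<le> coeff_at (Q, \<beta>) i))"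

definition egd_join :: "egd \<Rightarrow> egd \<Rightarrow> egd \<Rightarrow> bool" where
  "egd_join = (\<lambda>(R, \<gamma>) (S, \<delta>) (Q, \<beta>). list_all2 (\<le>) \<gamma> \<beta> \<and> list_all2 (\<le>) \<delta> \<beta> \<and>
     (\<exists>s. list_all2 (\<le>) (dims R) s \<and> list_all2 (\<le>) (dims S) s \<and>
          Q = add_tensor (expand s (R, \<gamma>)) (expand s (S, \<delta>))))"

section \<open>Geometric bound semantics\<close>

fun geo_event :: "event \<Rightarrow> egd \<Rightarrow> egd" where
  "geo_event (VarEq k a) (P, \<alpha>) =
     (mk_tensor ((dims P)[k := max (dims P ! k) (a + 2)])
        (\<lambda>i. entry P (i[k := min (i ! k) (dims P ! k - 1)])
               * (\<alpha> ! k) ^ (i ! k + 1 - dims P ! k) * of_bool (i ! k = a)),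
      \<alpha>[k := 0])"
| "geo_event (Flip \<rho>) (P, \<alpha>) = (scale_tensor \<rho> P, \<alpha>)"
| "geo_event (Neg E) (P, \<alpha>) =
     (let (R, \<gamma>) = geo_event E (P, \<alpha>)
      in (mk_tensor (dims R) (\<lambda>i. coeff_at (P, \<alpha>) i - entry R i), \<alpha>))"
| "geo_event (Conj E1 E2) A = geo_event E2 (geo_event E1 A)"

fun geo_sem :: "nat \<Rightarrow> prog \<Rightarrow> egd \<Rightarrow> egd \<Rightarrow> bool" where
  "geo_sem n Skip (P, \<alpha>) (Q, \<beta>) \<longleftrightarrow> \<beta> = \<alpha> \<and> Q = P"
| "geo_sem n (Seq P1 P2) (P, \<alpha>) (Q, \<beta>) \<longleftrightarrow>
     (\<exists>R \<gamma>. is_egd n (R, \<gamma>) \<and> geo_sem n P1 (P, \<alpha>) (R, \<gamma>) \<and> geo_sem n P2 (R, \<gamma>) (Q, \<beta>))"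
| "geo_sem n (SetZero k) (P, \<alpha>) (Q, \<beta>) \<longleftrightarrow>
     \<beta> = \<alpha>[k := 0] \<and>
     Q = mk_tensor ((dims P)[k := 2]) (\<lambda>i.
           if i ! k = 0
           then entry P (i[k := dims P ! k - 1]) / (1 - \<alpha> ! k) + (\<Sum>j<dims P ! k - 1. entry P (i[k := j]))
           else 0)"
| "geo_sem n (Incr k a) (P, \<alpha>) (Q, \<beta>) \<longleftrightarrow>
     \<beta> = \<alpha> \<and>
     Q = mk_tensor ((dims P)[k := dims P ! k + a])
           (\<lambda>i. if i ! k < a then 0 else entry P (i[k := i ! k - a]))"
| "geo_sem n (Decr k) (P, \<alpha>) (Q, \<beta>) \<longleftrightarrow>
     \<beta> = \<alpha> \<and>
     Q = mk_tensor ((dims P)[k := max (dims P ! k - 1) 2]) (\<lambda>i.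
           if i ! k = 0
           then entry P (i[k := 0])
                  + entry P (i[k := min (dims P ! k - 1) 1]) * (\<alpha> ! k) ^ (2 - dims P ! k)
           else entry P (i[k := min (dims P ! k - 1) (i ! k + 1)]) * (\<alpha> ! k) ^ (i ! k + 2 - dims P ! k))"
| "geo_sem n (If E P1 P2) (P, \<alpha>) (Q, \<beta>) \<longleftrightarrow>
     (\<exists>R \<gamma> S \<delta>. is_egd n (R, \<gamma>) \<and> is_egd n (S, \<delta>) \<and>
        geo_sem n P1 (geo_event E (P, \<alpha>)) (R, \<gamma>) \<and>
        geo_sem n P2 (geo_event (Neg E) (P, \<alpha>)) (S, \<delta>) \<and>
        egd_join (R, \<gamma>) (S, \<delta>) (Q, \<beta>))"
| "geo_sem n (While E B) (P, \<alpha>) (Q, \<beta>) \<longleftrightarrow>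
     (\<exists>c R \<gamma> S \<delta>. 0 \<le> c \<and> c < 1 \<and> is_egd n (R, \<gamma>) \<and> is_egd n (S, \<delta>) \<and>
        egd_le (P, \<alpha>) (R, \<gamma>) \<and>
        geo_sem n B (geo_event E (R, \<gamma>)) (S, \<delta>) \<and>
        egd_le (S, \<delta>) (scale_tensor c R, \<gamma>) \<and>
        geo_event (Neg E) (scale_tensor (1 / (1 - c)) R, \<gamma>) = (Q, \<beta>))"
| "geo_sem n Fail (P, \<alpha>) (Q, \<beta>) \<longleftrightarrow>
     \<beta> = replicate n 0 \<and> Q = mk_tensor (replicate n 1) (\<lambda>_. 0)"

end

theory Submission
  imports Defs
begin

text \<open>
  Fix \<open>z > 1\<close> and give every outcome with final state \<open>x\<close> and running time \<open>t\<close> the weight \<open>z ^ t\<close>.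
  A single step then costs a factor \<open>z\<close>, and by induction on the program the weighted final
  distribution stays below \<open>q\<close> times the EGD bound of the untimed program, for any prescribed
  \<open>q > 1\<close>, once \<open>z\<close> is close enough to 1. For a loop with contraction factor \<open>c < 1\<close>, weighting turns
  \<open>c\<close> into \<open>c * q'\<close> with \<open>q'\<close> close to 1, so that the geometric series over the iterations still
  converges, to at most \<open>q / (1 - c)\<close>. Finiteness of the weighted total mass means that the
  probability of running time \<open>t\<close> is at most a constant times \<open>(1 / z) ^ t\<close>.
\<close>

section \<open>Tensor coefficients\<close>

text \<open>The hypothesis bounds only the untimed program, and no geometric derivation for
  \<open>timed n P\<close> is built. Instead the clock is summed out: for each final state
  \<open>x\<close>, the generating function of the clock at \<open>z\<close> is compared with
  \<open>coeff_at\<close> at \<open>x\<close>. Tests and assignments of the program neither read nor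
  write the clock, so they act on this function exactly as on a mass function; only the ticks cost
  something. The number of ticks has no a priori bound, hence the multiplicative slack
  \<open>q\<close>. A sequence shares its slack between its two parts. A loop must give its body a
  slack that leaves the contraction below 1 and the sum over all iterations within the slack of the
  loop. So \<open>q\<close> has to be arbitrary in the induction. The weight \<open>z\<close> may
  depend on \<open>q\<close>, but not on the measure, because one \<open>z\<close> must serve all
  iterations of a loop. A second obstacle is the difference in negated events, which is meaningful
  only for finite mass. Finiteness is therefore derived at every test, from the weighted bound and
  the finite total mass of an EGD.\<close>

text \<open>Conditional probability of the event given the state. It is the common density by which
  \<open>restr\<close> and \<open>geo_event\<close> multiply, one on measures, the other on mass
  functions.\<close>

primrec event_weight :: "event \<Rightarrow> nat list \<Rightarrow> real" where
  "event_weight (VarEq k a) x = of_bool (x ! k = a)"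
| "event_weight (Flip \<rho>) x = \<rho>"
| "event_weight (Neg E) x = 1 - event_weight E x"
| "event_weight (Conj E1 E2) x = event_weight E1 x * event_weight E2 x"

lemma event_weight_bounds:
  assumes "wf_event n E"
  shows "0 \<le> event_weight E x" "event_weight E x \<le> 1"
  using assms by (induction E) (auto intro: mult_le_one)

text \<open>Tests are blind to the clock, which is appended as the last coordinate; hence weighting
  by time commutes with restriction.\<close>

lemma event_weight_append:
  assumes "wf_event n E" "length x = n"
  shows "event_weight E (x @ y) = event_weight E x"
  using assms by (induction E) (auto simp: nth_append)

lemma wf_event_Suc: "wf_event n E \<Longrightarrow> wf_event (Suc n) E"
  by (induction E) auto

section \<open>Mass functions of EGDs under expansion, order, join and scaling\<close>

definition clamp_idx :: "nat list \<Rightarrow> nat list \<Rightarrow> nat list" where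
  "clamp_idx d i = map2 (\<lambda>j d. min j (d - 1)) i d"

definition excess :: "nat list \<Rightarrow> nat list \<Rightarrow> nat list" where
  "excess d i = map2 (\<lambda>j d. j + 1 - d) i d"

lemma length_clamp_idx [simp]: "length (clamp_idx d i) = min (length i) (length d)"
  and length_excess [simp]: "length (excess d i) = min (length i) (length d)"
  by (simp_all add: clamp_idx_def excess_def)

lemma nth_clamp_idx [simp]: "l < length i \<Longrightarrow> l < length d \<Longrightarrow> clamp_idx d i ! l = min (i ! l) (d ! l - 1)"
  and nth_excess [simp]: "l < length i \<Longrightarrow> l < length d \<Longrightarrow> excess d i ! l = i ! l + 1 - d ! l"
  by (simp_all add: clamp_idx_def excess_def)

lemma coeff_at_eq:
  "coeff_at (P, \<alpha>) i = entry P (clamp_idx (dims P) i) * vec_power \<alpha> (excess (dims P) i)"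
  by (simp add: coeff_at_def clamp_idx_def excess_def)

lemma vec_power_Nil [simp]: "vec_power [] i = 1"
  and vec_power_Cons [simp]: "vec_power (a # \<alpha>) (j # i) = a ^ j * vec_power \<alpha> i"
  by (simp_all add: vec_power_def)

lemma vec_power_eq_prod:
  "length \<alpha> = length i \<Longrightarrow> vec_power \<alpha> i = (\<Prod>l<length i. \<alpha> ! l ^ (i ! l))"
  by (induction \<alpha> i rule: list_induct2) (simp_all add: prod.lessThan_Suc_shift del: prod.lessThan_Suc)

lemma in_box_iff: "i \<in> box d \<longleftrightarrow> length i = length d \<and> (\<forall>l<length d. i ! l < d ! l)"
  by (auto simp: box_def list_all2_conv_all_nth)

lemma finite_box: "finite (box d)"
proof (rule finite_subset)
  show "box d \<subseteq> {xs. set xs \<subseteq> {..Max (set d)} \<and> length xs = length d}"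
  proof safe
    fix i j assume i: "i \<in> box d" "j \<in> set i"
    then obtain l where l: "l < length d" "j = i ! l" by (auto simp: in_box_iff in_set_conv_nth)
    then have "d ! l \<in> set d" by auto
    then have "d ! l \<le> Max (set d)" by simp
    moreover have "i ! l < d ! l" using i l by (simp add: in_box_iff)
    ultimately show "j \<le> Max (set d)" using l(2) by linarith
  qed (auto simp: in_box_iff)
  show "finite {xs. set xs \<subseteq> {..Max (set d)} \<and> length xs = length d}"
    by (rule finite_lists_length_eq) auto
qed

lemma clamp_idx_in_box:
  assumes "length i = length d" "\<forall>l<length d. 1 \<le> d ! l"
  shows "clamp_idx d i \<in> box d"
  using assms by (fastforce simp: in_box_iff min_less_iff_disj)

lemma is_egdD:
  assumes "is_egd n (P, \<alpha>)"
  shows "length (dims P) = n" "\<forall>l<n. 1 \<le> dims P ! l" "length \<alpha> = n"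
    "\<And>i. i \<in> box (dims P) \<Longrightarrow> 0 \<le> entry P i" "\<forall>l<n. 0 \<le> \<alpha> ! l \<and> \<alpha> ! l < 1"
  using assms by (auto simp: is_egd_def nonneg_tensor_def)

lemma is_egd_mk_tensor:
  assumes "length d = n" "\<forall>l<n. 1 \<le> d ! l" "length \<alpha> = n" "\<forall>l<n. 0 \<le> \<alpha> ! l \<and> \<alpha> ! l < 1"
    "\<And>i. i \<in> box d \<Longrightarrow> 0 \<le> f i"
  shows "is_egd n (mk_tensor d f, \<alpha>)"
  using assms by (auto simp: is_egd_def nonneg_tensor_def mk_tensor_def in_set_conv_nth)

lemma vec_power_nonneg:
  assumes "length \<alpha> = length i" "\<forall>l<length i. 0 \<le> \<alpha> ! l"
  shows "0 \<le> vec_power \<alpha> i"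
  using assms by (auto simp: vec_power_eq_prod intro!: prod_nonneg)

lemma vec_power_mono:
  assumes "length \<alpha> = length i" "length \<beta> = length i" "\<forall>l<length i. 0 \<le> \<alpha> ! l" "list_all2 (\<le>) \<alpha> \<beta>"
  shows "vec_power \<alpha> i \<le> vec_power \<beta> i"
  using assms by (auto simp: vec_power_eq_prod list_all2_conv_all_nth intro!: prod_mono power_mono)

lemma coeff_at_nonneg:
  assumes "is_egd n A" "length i = n"
  shows "0 \<le> coeff_at A i"
proof -
  obtain P \<alpha> where A: "A = (P, \<alpha>)" by force
  note D = is_egdD[OF assms(1)[unfolded A]]
  have "0 \<le> entry P (clamp_idx (dims P) i)" using assms(2) D by (intro D(4) clamp_idx_in_box) auto
  moreover have "0 \<le> vec_power \<alpha> (excess (dims P) i)" using assms(2) D by (intro vec_power_nonneg) auto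
  ultimately show ?thesis by (simp add: A coeff_at_eq)
qed

lemma coeff_at_in_box:
  assumes "length (dims P) = n" "length \<alpha> = n" "i \<in> box (dims P)"
  shows "coeff_at (P, \<alpha>) i = entry P i"
proof -
  have "clamp_idx (dims P) i = i"
    using assms by (intro nth_equalityI) (auto simp: in_box_iff min_def Suc_leI dest!: spec)
  moreover have "vec_power \<alpha> (excess (dims P) i) = 1"
    using assms by (subst vec_power_eq_prod) (auto simp: in_box_iff Suc_leI intro!: prod.neutral)
  ultimately show ?thesis by (simp add: coeff_at_eq)
qed

text \<open>In each coordinate the decay steps beyond the size of \<open>P\<close> split into those
  up to the border of \<open>s\<close> and those beyond it. So expansion leaves the mass function
  unchanged, and two EGDs can be compared at a common size.\<close>

lemma coeff_at_expand:
  assumes "length (dims P) = n" "\<forall>l<n. 1 \<le> dims P ! l" "length \<alpha> = n" "length i = n"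
    "list_all2 (\<le>) (dims P) s"
  shows "coeff_at (P, \<alpha>) i = coeff_at (P, \<alpha>) (clamp_idx s i) * vec_power \<alpha> (excess s i)"
proof -
  let ?d = "dims P"
  have s: "length s = n" "\<And>l. l < n \<Longrightarrow> ?d ! l \<le> s ! l" "\<And>l. l < n \<Longrightarrow> 1 \<le> ?d ! l"
    using assms by (auto simp: list_all2_conv_all_nth)
  have "clamp_idx ?d (clamp_idx s i) = clamp_idx ?d i"
  proof (intro nth_equalityI)
    fix l assume "l < length (clamp_idx ?d (clamp_idx s i))"
    then show "clamp_idx ?d (clamp_idx s i) ! l = clamp_idx ?d i ! l"
      using assms s(1) s(2,3)[of l] by simp
  qed (use assms s in auto)
  moreover have "vec_power \<alpha> (excess ?d i) = vec_power \<alpha> (excess ?d (clamp_idx s i)) * vec_power \<alpha> (excess s i)"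
  proof -
    have "i ! l + 1 - ?d ! l = (min (i ! l) (s ! l - 1) + 1 - ?d ! l) + (i ! l + 1 - s ! l)" if "l < n" for l
      using s(2,3)[OF that] by (auto simp: min_def)
    then have "(\<Prod>l<n. \<alpha> ! l ^ (excess ?d i ! l)) =
        (\<Prod>l<n. \<alpha> ! l ^ (excess ?d (clamp_idx s i) ! l) * \<alpha> ! l ^ (excess s i ! l))"
      using assms s(1) by (intro prod.cong) (auto simp: power_add[symmetric])
    then show ?thesis
      using assms s(1) by (simp add: vec_power_eq_prod prod.distrib)
  qed
  ultimately show ?thesis by (simp add: coeff_at_eq)
qed

lemma coeff_at_mk_tensor:
  assumes "length d = n" "\<forall>l<n. 1 \<le> d ! l" "length i = n"
  shows "coeff_at (mk_tensor d f, \<alpha>) i = f (clamp_idx d i) * vec_power \<alpha> (excess d i)"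
  using clamp_idx_in_box[of i d] assms by (simp add: coeff_at_eq mk_tensor_def)

text \<open>\<open>egd_le\<close> tests the masses only on the finite box of the joint size. Beyond
  it both sides continue from the border cells, each with its own rates, and the order of the rates
  preserves the inequality.\<close>

lemma coeff_at_mono:
  assumes A: "is_egd n A" and B: "is_egd n B" and le: "egd_le A B" and i: "length i = n"
  shows "coeff_at A i \<le> coeff_at B i"
proof -
  obtain P \<alpha> Q \<beta> where AB: "A = (P, \<alpha>)" "B = (Q, \<beta>)" by force
  note DA = is_egdD[OF A[unfolded AB]] and DB = is_egdD[OF B[unfolded AB]]
  define s where "s = map2 max (dims P) (dims Q)"
  have s: "length s = n" "list_all2 (\<le>) (dims P) s" "list_all2 (\<le>) (dims Q) s" "\<forall>l<n. 1 \<le> s ! l"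
    using DA DB by (auto simp: s_def list_all2_conv_all_nth max_def)
  have box: "clamp_idx s i \<in> box s" using s i by (intro clamp_idx_in_box) auto
  have "coeff_at A i = coeff_at A (clamp_idx s i) * vec_power \<alpha> (excess s i)"
    unfolding AB using DA s i by (intro coeff_at_expand) auto
  also have "\<dots> \<le> coeff_at B (clamp_idx s i) * vec_power \<beta> (excess s i)"
    using le box DA DB s i coeff_at_nonneg[OF B, of "clamp_idx s i"]
    by (intro mult_mono vec_power_mono vec_power_nonneg) (auto simp: egd_le_def s_def AB)
  also have "\<dots> = coeff_at B i"
    unfolding AB using DB s i by (intro coeff_at_expand[symmetric]) auto
  finally show ?thesis .
qed

text \<open>At the joint size the join adds entries, but beyond it decays with a common rate that
  may exceed both given ones. Equality is thus certain only inside the box.\<close>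

lemma coeff_at_join:
  assumes A: "is_egd n A" and B: "is_egd n B" and j: "egd_join A B C" and i: "length i = n"
  shows "coeff_at A i + coeff_at B i \<le> coeff_at C i"
proof -
  obtain P \<alpha> Q \<beta> U \<gamma> where AB: "A = (P, \<alpha>)" "B = (Q, \<beta>)" "C = (U, \<gamma>)"
    by (metis surj_pair)
  note DA = is_egdD[OF A[unfolded AB]] and DB = is_egdD[OF B[unfolded AB]]
  from j obtain s where s: "list_all2 (\<le>) (dims P) s" "list_all2 (\<le>) (dims Q) s"
    and U: "U = add_tensor (expand s A) (expand s B)"
    and r: "list_all2 (\<le>) \<alpha> \<gamma>" "list_all2 (\<le>) \<beta> \<gamma>"
    by (auto simp: egd_join_def AB)
  have l: "length s = n" "\<forall>l<n. 1 \<le> s ! l" "length \<gamma> = n"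
    using s r DA by (auto simp: list_all2_conv_all_nth intro: order_trans)
  have box: "clamp_idx s i \<in> box s" using l i by (intro clamp_idx_in_box) auto
  have "coeff_at C i = (coeff_at A (clamp_idx s i) + coeff_at B (clamp_idx s i)) * vec_power \<gamma> (excess s i)"
    using box l i unfolding AB U add_tensor_def
    by (subst coeff_at_mk_tensor[where n = n]) (auto simp: expand_def mk_tensor_def)
  moreover have "coeff_at A i \<le> coeff_at A (clamp_idx s i) * vec_power \<gamma> (excess s i)"
    unfolding AB using DA s i l r coeff_at_nonneg[OF A, of "clamp_idx s i"]
    by (subst coeff_at_expand[where s = s and n = n]) (auto intro!: mult_left_mono vec_power_mono simp: AB)
  moreover have "coeff_at B i \<le> coeff_at B (clamp_idx s i) * vec_power \<gamma> (excess s i)"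
    unfolding AB using DB s i l r coeff_at_nonneg[OF B, of "clamp_idx s i"]
    by (subst coeff_at_expand[where s = s and n = n]) (auto intro!: mult_left_mono vec_power_mono simp: AB)
  ultimately show ?thesis by (simp add: algebra_simps)
qed

lemma is_egd_scale_tensor:
  assumes "is_egd n (P, \<alpha>)" "0 \<le> c"
  shows "is_egd n (scale_tensor c P, \<alpha>)"
  unfolding scale_tensor_def using is_egdD[OF assms(1)] assms(2) by (intro is_egd_mk_tensor) auto

lemma coeff_at_scale_tensor:
  assumes "is_egd n (P, \<alpha>)" "length i = n"
  shows "coeff_at (scale_tensor c P, \<alpha>) i = c * coeff_at (P, \<alpha>) i"
  unfolding scale_tensor_def using is_egdD[OF assms(1)] assms(2)
  by (subst coeff_at_mk_tensor[where n = n]) (auto simp: coeff_at_eq mult.assoc)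

text \<open>
  Isolates coordinate \<open>k\<close>: the last factor is common to all tensors whose sizes and rates agree
  with \<open>d\<close> and \<open>\<alpha>\<close> off \<open>k\<close>.
\<close>

lemma coeff_at_split:
  assumes "dims Q = d[k := D]" "length d = n" "length \<alpha> = n" "length x = n" "k < n"
  shows "coeff_at (Q, \<alpha>[k := b]) (x[k := j]) =
    entry Q ((clamp_idx d x)[k := min j (D - 1)]) * b ^ (j + 1 - D)
      * (\<Prod>l\<in>{..<n} - {k}. \<alpha> ! l ^ (x ! l + 1 - d ! l))"
proof -
  have "clamp_idx (dims Q) (x[k := j]) = (clamp_idx d x)[k := min j (D - 1)]"
    using assms by (intro nth_equalityI) (auto simp: nth_list_update)
  moreover have "vec_power (\<alpha>[k := b]) (excess (dims Q) (x[k := j])) =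
      b ^ (j + 1 - D) * (\<Prod>l\<in>{..<n} - {k}. \<alpha> ! l ^ (x ! l + 1 - d ! l))"
    using assms by (subst vec_power_eq_prod) (auto simp: prod.remove[of _ k])
  ultimately show ?thesis by (simp add: coeff_at_eq)
qed

lemma coeff_at_split_mk_tensor:
  assumes "length d = n" "length \<alpha> = n" "length x = n" "k < n" "1 \<le> D" "\<forall>l<n. 1 \<le> d ! l"
  shows "coeff_at (mk_tensor (d[k := D]) f, \<alpha>[k := b]) x =
    f ((clamp_idx d x)[k := min (x ! k) (D - 1)]) * b ^ (x ! k + 1 - D)
      * (\<Prod>l\<in>{..<n} - {k}. \<alpha> ! l ^ (x ! l + 1 - d ! l))"
proof -
  have "(clamp_idx d x)[k := min (x ! k) (D - 1)] \<in> box (d[k := D])"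
    using assms by (auto simp: in_box_iff nth_list_update min_less_iff_disj Suc_le_eq)
  then show ?thesis
    using coeff_at_split[of "mk_tensor (d[k := D]) f" d k D n \<alpha> x b "x ! k"] assms
    by (simp add: mk_tensor_def)
qed

lemma coeff_at_split_self:
  assumes "is_egd n (P, \<alpha>)" "length x = n" "k < n"
  shows "coeff_at (P, \<alpha>) (x[k := j]) =
    entry P ((clamp_idx (dims P) x)[k := min j (dims P ! k - 1)]) * (\<alpha> ! k) ^ (j + 1 - dims P ! k)
      * (\<Prod>l\<in>{..<n} - {k}. \<alpha> ! l ^ (x ! l + 1 - dims P ! l))"
  using coeff_at_split[of P "dims P" k "dims P ! k" n \<alpha> x "\<alpha> ! k" j] is_egdD[OF assms(1)] assms
  by simp

text \<open>The geometric event semantics is exact: it multiplies masses by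
  \<open>event_weight\<close>. The second and fourth clauses strengthen the induction for
  \<open>Neg\<close>. A difference formed on the cells of the tensor extends correctly to the tail
  only if the weight is constant beyond the border, which means that clamping to the new size, or to
  any larger one, does not change it.\<close>

lemma coeff_at_geo_event:
  assumes "is_egd n A" "wf_event n E"
  shows "is_egd n (geo_event E A) \<and> list_all2 (\<le>) (dims (fst A)) (dims (fst (geo_event E A))) \<and>
    (\<forall>i. length i = n \<longrightarrow> coeff_at (geo_event E A) i = event_weight E i * coeff_at A i) \<and>
    (\<forall>s i. list_all2 (\<le>) (dims (fst (geo_event E A))) s \<longrightarrow> length i = n \<longrightarrow>
       event_weight E (clamp_idx s i) = event_weight E i)"
  using assms
proof (induction E arbitrary: A)
  case (VarEq k a)
  obtain P \<alpha> where A: "A = (P, \<alpha>)" by force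
  note D = is_egdD[OF VarEq.prems(1)[unfolded A]]
  have k: "k < n" using VarEq.prems by simp
  let ?d = "dims P" and ?D = "max (dims P ! k) (a + 2)"
  let ?f = "\<lambda>i. entry P (i[k := min (i ! k) (dims P ! k - 1)])
               * (\<alpha> ! k) ^ (i ! k + 1 - dims P ! k) * of_bool (i ! k = a)"
  have g: "geo_event (VarEq k a) A = (mk_tensor (?d[k := ?D]) ?f, \<alpha>[k := 0])"
    by (simp add: A)
  have box: "i[k := min (i ! k) (?d ! k - 1)] \<in> box ?d" if "i \<in> box (?d[k := ?D])" for i
    using that D k by (auto simp: in_box_iff nth_list_update min_less_iff_disj Suc_le_eq)
  have egd: "is_egd n (geo_event (VarEq k a) A)"
    unfolding g using D k box
    by (intro is_egd_mk_tensor) (auto simp: nth_list_update intro!: mult_nonneg_nonneg)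
  have dims: "dims (fst (geo_event (VarEq k a) A)) = ?d[k := ?D]"
    by (simp add: g mk_tensor_def)
  have "coeff_at (geo_event (VarEq k a) A) i = event_weight (VarEq k a) i * coeff_at A i"
    if i: "length i = n" for i
  proof -
    \<comment> \<open>The size \<open>a + 2\<close> pays off here: the border index is at least
      \<open>a + 1\<close>, so clamping never produces the value \<open>a\<close> by
      accident.\<close>
    let ?m = "min (i ! k) (?D - 1)"
    have m: "?m = a \<longleftrightarrow> i ! k = a" by (auto simp: min_def max_def)
    show ?thesis
    proof (cases "i ! k = a")
      case True
      \<comment> \<open>The index lies inside the tensor, so the new rate 0 occurs as
        \<open>0 ^ 0 = 1\<close>.\<close>
      have D': "i ! k + 1 - ?D = 0" using True by simp
      have "?m = a" using m True by blast
      then show ?thesis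
        using True D' coeff_at_split_self[of n P \<alpha> i k "i ! k"] D k i VarEq.prems(1)
        unfolding g
        by (subst coeff_at_split_mk_tensor[where n = n]) (auto simp: A)
    next
      case False
      then have "?m \<noteq> a" using m by blast
      then show ?thesis
        using False D k i unfolding g
        by (subst coeff_at_split_mk_tensor[where n = n]) (auto simp: A)
    qed
  qed
  moreover have "event_weight (VarEq k a) (clamp_idx s i) = event_weight (VarEq k a) i"
    if "list_all2 (\<le>) (dims (fst (geo_event (VarEq k a) A))) s" "length i = n" for s i
  proof -
    have "a + 2 \<le> s ! k" "length s = n"
      using that(1) D k unfolding dims by (auto simp: list_all2_conv_all_nth dest!: spec[of _ k])
    then show ?thesis using that(2) k by (auto simp: min_def)
  qed
  moreover have "list_all2 (\<le>) (dims (fst A)) (dims (fst (geo_event (VarEq k a) A)))"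
    unfolding dims using D k by (auto simp: A list_all2_conv_all_nth nth_list_update)
  ultimately show ?case using egd by blast
next
  case (Flip \<rho>)
  obtain P \<alpha> where A: "A = (P, \<alpha>)" by force
  have "dims (scale_tensor \<rho> P) = dims P" by (simp add: scale_tensor_def mk_tensor_def)
  then show ?case
    using Flip is_egd_scale_tensor[of n P \<alpha> \<rho>] coeff_at_scale_tensor[of n P \<alpha> _ \<rho>]
    by (auto simp: A list_all2_same)
next
  case (Neg E)
  obtain P \<alpha> where A: "A = (P, \<alpha>)" by force
  obtain R \<gamma> where R: "geo_event E A = (R, \<gamma>)" by force
  have wf: "wf_event n E" using Neg.prems by simp
  note IH = Neg.IH[OF Neg.prems(1) wf, unfolded R]
  note D = is_egdD[OF Neg.prems(1)[unfolded A]]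
  have egdR: "is_egd n (R, \<gamma>)" using IH by simp
  note DR = is_egdD[OF egdR]
  let ?f = "\<lambda>i. coeff_at A i - entry R i"
  have g: "geo_event (Neg E) A = (mk_tensor (dims R) ?f, \<alpha>)"
    using R by (simp add: A)
  \<comment> \<open>On the box, entries of \<open>R\<close> are masses, so the subtraction becomes
    multiplication by the complementary weight. This also shows that the difference is
    nonnegative.\<close>
  have f: "?f i = (1 - event_weight E i) * coeff_at A i" if "i \<in> box (dims R)" for i
    using coeff_at_in_box[of R n \<gamma> i] IH that DR by (auto simp: algebra_simps in_box_iff)
  have "0 \<le> ?f i" if "i \<in> box (dims R)" for i
    unfolding f[OF that] using that DR event_weight_bounds[OF wf] coeff_at_nonneg[OF Neg.prems(1), of i]
    by (auto simp: in_box_iff)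
  then have egd: "is_egd n (geo_event (Neg E) A)"
    unfolding g using D DR by (intro is_egd_mk_tensor) auto
  have dims: "dims (fst (geo_event (Neg E) A)) = dims R" by (simp add: g mk_tensor_def)
  have "coeff_at (geo_event (Neg E) A) i = event_weight (Neg E) i * coeff_at A i"
    if i: "length i = n" for i
  proof -
    let ?i = "clamp_idx (dims R) i"
    have "coeff_at (geo_event (Neg E) A) i = ?f ?i * vec_power \<alpha> (excess (dims R) i)"
      unfolding g using DR i by (intro coeff_at_mk_tensor) auto
    also have "?f ?i = (1 - event_weight E ?i) * coeff_at A ?i"
      using i DR by (intro f clamp_idx_in_box) auto
    \<comment> \<open>Fourth clause for \<open>s = dims R\<close>: the weight at the border cell is
      the weight of everything that is clamped to it.\<close>
    also have "event_weight E ?i = event_weight E i"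
      using IH i by (auto simp: list_all2_same)
    \<comment> \<open>The result keeps the rates \<open>\<alpha>\<close> of \<open>A\<close>, not
      those of \<open>R\<close>, so its tail is that of \<open>A\<close> expanded to the size of
      \<open>R\<close>.\<close>
    also have "(1 - event_weight E i) * coeff_at A ?i * vec_power \<alpha> (excess (dims R) i)
        = (1 - event_weight E i) * coeff_at A i"
      using coeff_at_expand[of P n \<alpha> i "dims R"] D i IH by (simp add: A mult.assoc)
    finally show ?thesis by simp
  qed
  then show ?case using egd IH unfolding dims by auto
next
  case (Conj E1 E2)
  note IH1 = Conj.IH(1)[of A] and IH2 = Conj.IH(2)[of "geo_event E1 A"]
  have wf: "wf_event n E1" "wf_event n E2" using Conj.prems by auto
  \<comment> \<open>A size above the final one is also above the intermediate one, as the invariance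
    of the weight of \<open>E1\<close> under clamping requires.\<close>
  have t: "list_all2 (\<le>) a c" if "list_all2 (\<le>) a b" "list_all2 (\<le>) b c" for a b c :: "nat list"
    using that by (rule list_all2_trans[rotated 1]) auto
  show ?case
    using IH1[OF Conj.prems(1) wf(1)] IH2[OF _ wf(2)] by (auto intro: t)
qed

section \<open>Assignments: pushing mass functions forward\<close>

lemma suminf_indicator_ennreal:
  "(\<Sum>j. if j = a then f j else (0::ennreal)) = f a"
  using suminf_finite[of "{a}" "\<lambda>j. if j = a then f j else (0::ennreal)"] by simp

text \<open>The left side is the pushed-forward mass at \<open>x\<close>, in the form
  \<open>if g j = x ! k\<close> that all three kinds of assignment share. From the last index of the
  tensor on, the masses along coordinate \<open>k\<close> form a geometric series with ratio
  \<open>\<alpha> ! k\<close>; its sum is the quotient by \<open>1 - \<alpha> ! k\<close> in the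
  definition of \<open>geo_sem\<close>.\<close>

lemma coeff_at_SetZero:
  assumes A: "is_egd n (P, \<alpha>)" and g: "geo_sem n (SetZero k) (P, \<alpha>) (Q, \<beta>)"
    and x: "length x = n" and k: "k < n"
  shows "(\<Sum>j. if 0 = x ! k then ennreal (coeff_at (P, \<alpha>) (x[k := j])) else 0)
    \<le> ennreal (coeff_at (Q, \<beta>) x)"
proof (cases "x ! k = 0")
  case True
  note D = is_egdD[OF A]
  define e where "e j = entry P ((clamp_idx (dims P) x)[k := j])" for j
  define r where "r = (\<Prod>l\<in>{..<n} - {k}. \<alpha> ! l ^ (x ! l + 1 - dims P ! l))"
  define f where "f = (\<lambda>i. if i ! k = 0
           then entry P (i[k := dims P ! k - 1]) / (1 - \<alpha> ! k) + (\<Sum>j<dims P ! k - 1. entry P (i[k := j]))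
           else 0)"
  define m where "m = dims P ! k - 1"
  have dk: "dims P ! k = Suc m" using D(2) k by (auto simp: m_def dest!: spec[of _ k])
  have a: "0 \<le> \<alpha> ! k" "\<alpha> ! k < 1" using D k by auto
  have c: "coeff_at (P, \<alpha>) (x[k := j]) = e (min j m) * (\<alpha> ! k) ^ (j - m) * r" for j
    using coeff_at_split_self[OF A x k] by (simp add: e_def r_def dk)
  have "(\<lambda>j. coeff_at (P, \<alpha>) (x[k := j + m])) sums (e m * (1 / (1 - \<alpha> ! k)) * r)"
    unfolding c using a by (simp only: min.absorb2 le_add2 add_diff_cancel_right')
      (intro sums_mult sums_mult2 geometric_sums, simp)
  then have "(\<lambda>j. coeff_at (P, \<alpha>) (x[k := j])) sums
      (e m * (1 / (1 - \<alpha> ! k)) * r + (\<Sum>j<m. coeff_at (P, \<alpha>) (x[k := j])))"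
    by (subst (asm) sums_iff_shift) (simp add: algebra_simps)
  also have "(\<Sum>j<m. coeff_at (P, \<alpha>) (x[k := j])) = (\<Sum>j<m. e j) * r"
    by (simp add: c sum_distrib_right)
  also have "e m * (1 / (1 - \<alpha> ! k)) * r + (\<Sum>j<m. e j) * r = coeff_at (Q, \<beta>) x"
  proof -
    have Q: "Q = mk_tensor ((dims P)[k := 2]) f" "\<beta> = \<alpha>[k := 0]" using g by (simp_all add: f_def)
    \<comment> \<open>Since \<open>x ! k = 0\<close>, the exponent of the rate 0 is the truncated
      difference \<open>1 - 2\<close>, which is 0, and the factor is 1.\<close>
    have "coeff_at (Q, \<beta>) x =
        f ((clamp_idx (dims P) x)[k := min (x ! k) (2 - 1)]) * 0 ^ (x ! k + 1 - 2) * r"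
      unfolding Q r_def using D x k by (intro coeff_at_split_mk_tensor) simp_all
    then show ?thesis
      using D(1) x k True by (simp add: f_def dk e_def algebra_simps)
  qed
  finally have s: "(\<lambda>j. coeff_at (P, \<alpha>) (x[k := j])) sums coeff_at (Q, \<beta>) x" .
  have "(\<Sum>j. ennreal (coeff_at (P, \<alpha>) (x[k := j]))) = ennreal (coeff_at (Q, \<beta>) x)"
    using coeff_at_nonneg[OF A] x sums_unique[OF s] s
    by (subst suminf_ennreal2) (auto simp: sums_iff)
  then show ?thesis using True by simp
qed simp

text \<open>A state has at most one preimage, and shifting index and size together by
  \<open>a\<close> leaves the excess unchanged.\<close>

lemma coeff_at_Incr:
  assumes A: "is_egd n (P, \<alpha>)" and g: "geo_sem n (Incr k a) (P, \<alpha>) (Q, \<beta>)"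
    and x: "length x = n" and k: "k < n"
  shows "(\<Sum>j. if j + a = x ! k then ennreal (coeff_at (P, \<alpha>) (x[k := j])) else 0)
    \<le> ennreal (coeff_at (Q, \<beta>) x)"
proof (cases "a \<le> x ! k")
  case True
  note D = is_egdD[OF A]
  have eq: "j + a = x ! k \<longleftrightarrow> j = x ! k - a" for j using True by auto
  let ?d = "dims P ! k"
  have dk: "1 \<le> ?d" using D k by auto
  define f where "f = (\<lambda>i. if i ! k < a then 0 else entry P (i[k := i ! k - a]))"
  define y where "y = clamp_idx (dims P) x"
  have y: "length y = n" using x D by (simp add: y_def)
  define M where "M = min (x ! k) (?d + a - 1)"
  have Q: "Q = mk_tensor ((dims P)[k := ?d + a]) f" "\<beta> = \<alpha>[k := \<alpha> ! k]"
    using g by (auto simp: f_def)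
  have m: "a \<le> M" "M - a = min (x ! k - a) (?d - 1)"
    "x ! k + 1 - (?d + a) = x ! k - a + 1 - ?d"
    using True dk unfolding M_def by linarith+
  have "f (y[k := M]) = entry P (y[k := min (x ! k - a) (?d - 1)])"
    using m(1) y k unfolding m(2)[symmetric] by (simp add: f_def)
  then have "coeff_at (P, \<alpha>) (x[k := x ! k - a]) = coeff_at (Q, \<beta>) x"
    unfolding coeff_at_split_self[OF A x k] Q m(3)[symmetric] using D x k dk
    by (subst coeff_at_split_mk_tensor[where n = n and k = k]) (simp_all add: y_def M_def trans_le_add1)
  then show ?thesis by (simp add: eq suminf_indicator_ennreal)
next
  case False
  then have "j + a \<noteq> x ! k" for j by auto
  then show ?thesis by simp
qed

text \<open>Truncation gives the value 0 two preimages, 0 and 1; every other value has one. The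
  lower bound 2 on the new size keeps the merged cell 0 apart from the border cell, which is the one
  that is continued geometrically.\<close>

lemma coeff_at_Decr:
  assumes A: "is_egd n (P, \<alpha>)" and g: "geo_sem n (Decr k) (P, \<alpha>) (Q, \<beta>)"
    and x: "length x = n" and k: "k < n"
  shows "(\<Sum>j. if j - 1 = x ! k then ennreal (coeff_at (P, \<alpha>) (x[k := j])) else 0)
    \<le> ennreal (coeff_at (Q, \<beta>) x)"
proof -
  note D = is_egdD[OF A]
  let ?d = "dims P ! k"
  have dk: "1 \<le> ?d" using D k by auto
  define f where "f = (\<lambda>i. if i ! k = 0
           then entry P (i[k := 0]) + entry P (i[k := min (?d - 1) 1]) * (\<alpha> ! k) ^ (2 - ?d)
           else entry P (i[k := min (?d - 1) (i ! k + 1)]) * (\<alpha> ! k) ^ (i ! k + 2 - ?d))"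
  define y where "y = clamp_idx (dims P) x"
  have y: "length y = n" using x D by (simp add: y_def)
  define M where "M = min (x ! k) (max (?d - 1) 2 - 1)"
  have Q: "Q = mk_tensor ((dims P)[k := max (?d - 1) 2]) f" "\<beta> = \<alpha>[k := \<alpha> ! k]"
    using g by (auto simp: f_def)
  define r where "r = (\<Prod>l\<in>{..<n} - {k}. \<alpha> ! l ^ (x ! l + 1 - dims P ! l))"
  have cQ: "coeff_at (Q, \<beta>) x = f (y[k := M]) * \<alpha> ! k ^ (x ! k + 1 - max (?d - 1) 2) * r"
    unfolding Q y_def r_def M_def using D x k dk by (intro coeff_at_split_mk_tensor) simp_all
  have cP: "coeff_at (P, \<alpha>) (x[k := j]) =
      entry P (y[k := min j (?d - 1)]) * (\<alpha> ! k) ^ (j + 1 - ?d) * r" for j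
    unfolding y_def r_def by (rule coeff_at_split_self[OF A x k])
  have nn: "0 \<le> coeff_at (P, \<alpha>) (x[k := j])" for j using coeff_at_nonneg[OF A] x by simp
  show ?thesis
  proof (cases "x ! k = 0")
    case True
    have "(\<Sum>j. if j - 1 = x ! k then ennreal (coeff_at (P, \<alpha>) (x[k := j])) else 0) =
      (\<Sum>j\<in>{0, 1}. if j - 1 = x ! k then ennreal (coeff_at (P, \<alpha>) (x[k := j])) else 0)"
      by (rule suminf_finite) (auto simp: True)
    also have "\<dots> = ennreal (coeff_at (P, \<alpha>) (x[k := 0]) + coeff_at (P, \<alpha>) (x[k := 1]))"
      using nn by (simp add: True)
    also have "coeff_at (P, \<alpha>) (x[k := 0]) + coeff_at (P, \<alpha>) (x[k := 1]) = coeff_at (Q, \<beta>) x"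
    proof -
      have e: "x ! k + 1 - max (?d - 1) 2 = 0" "1 + 1 - ?d = 2 - ?d" "0 + 1 - ?d = 0" "M = 0"
        using True dk by (auto simp: M_def)
      have "f (y[k := 0]) = entry P (y[k := 0]) + entry P (y[k := min 1 (?d - 1)]) * (\<alpha> ! k) ^ (2 - ?d)"
        using y k by (simp add: f_def min.commute)
      then show ?thesis unfolding cQ cP e by (simp add: algebra_simps)
    qed
    finally show ?thesis by simp
  next
    case False
    have eq: "j - 1 = x ! k \<longleftrightarrow> j = x ! k + 1" for j using False by auto
    \<comment> \<open>The third equation splits the decay of the preimage into the part stored in
      the entry of \<open>Q\<close> (nonzero only for \<open>?d \<le> 2\<close>, when the new size
      is 2) and the part beyond the border of \<open>Q\<close>.\<close>
    have m: "M \<noteq> 0" "min (?d - 1) (M + 1) = min (x ! k + 1) (?d - 1)"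
      "x ! k + 1 + 1 - ?d = (M + 2 - ?d) + (x ! k + 1 - max (?d - 1) 2)"
      using False dk unfolding M_def by linarith+
    have "f (y[k := M]) = entry P (y[k := min (x ! k + 1) (?d - 1)]) * (\<alpha> ! k) ^ (M + 2 - ?d)"
      using m(1) y k unfolding m(2)[symmetric] by (simp add: f_def)
    then have "coeff_at (P, \<alpha>) (x[k := x ! k + 1]) = coeff_at (Q, \<beta>) x"
      unfolding cQ cP m(3) power_add by (simp only: mult.assoc)
    then show ?thesis unfolding eq suminf_indicator_ennreal by simp
  qed
qed

section \<open>Total mass\<close>

lemma countable_vecs [simp]: "countable (vecs n)"
  by (rule countable_subset[OF subset_UNIV]) simp

lemma nn_integral_pairs:
  fixes g :: "'a \<times> 'b \<Rightarrow> ennreal"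
  assumes "countable A" "countable B"
  shows "(\<integral>\<^sup>+p. g p \<partial>count_space (A \<times> B)) = (\<integral>\<^sup>+x. \<integral>\<^sup>+y. g (x, y) \<partial>count_space B \<partial>count_space A)"
proof -
  interpret B: sigma_finite_measure "count_space B"
    using assms by (rule_tac sigma_finite_measure_count_space_countable)
  show ?thesis
    using assms B.nn_integral_fst[of g "count_space A"]
    by (simp add: pair_measure_countable)
qed

lemma bij_betw_vecs_Cons: "bij_betw (\<lambda>(j, x). j # x) (UNIV \<times> vecs n) (vecs (Suc n))"
  by (rule bij_betwI[where g = "\<lambda>x. (hd x, tl x)"]) (auto simp: vecs_def length_Suc_conv)

lemma bij_betw_vecs_snoc: "bij_betw (\<lambda>(x, t). x @ [t]) (vecs n \<times> UNIV) (vecs (Suc n))"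
  by (rule bij_betwI[where g = "\<lambda>x. (butlast x, last x)"])
    (auto simp: vecs_def simp flip: length_greater_0_conv)

lemma nn_integral_vecs_Cons:
  "(\<integral>\<^sup>+y. g y \<partial>count_space (vecs (Suc n))) = (\<Sum>j. \<integral>\<^sup>+x. g (j # x) \<partial>count_space (vecs n))"
  by (subst nn_integral_bij_count_space[OF bij_betw_vecs_Cons, symmetric])
    (simp add: nn_integral_pairs nn_integral_count_space_nat)

text \<open>Separates the clock from the program variables. The \<open>Cons\<close> variant serves
  the induction over the coordinates of a tensor.\<close>

lemma nn_integral_vecs_snoc:
  "(\<integral>\<^sup>+y. g y \<partial>count_space (vecs (Suc n))) = (\<integral>\<^sup>+x. (\<Sum>t. g (x @ [t])) \<partial>count_space (vecs n))"
  by (subst nn_integral_bij_count_space[OF bij_betw_vecs_snoc, symmetric])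
    (simp add: nn_integral_pairs nn_integral_count_space_nat)

lemma suminf_power_excess_finite:
  assumes "0 \<le> a" "a < (1::real)"
  shows "(\<Sum>j. ennreal (a ^ (j + 1 - d))) < \<top>"
proof -
  have "summable (\<lambda>j. a ^ Suc j)" using assms by (intro summable_Suc_iff[THEN iffD2] summable_geometric) simp
  then have "summable (\<lambda>j. a ^ (j + d + 1 - d))" by simp
  then have "summable (\<lambda>j. a ^ (j + 1 - d))"
    by (rule summable_iff_shift[THEN iffD1])
  then show ?thesis using assms by (subst suminf_ennreal2) auto
qed

text \<open>By Tonelli the integral factors into one series per coordinate, each constant at first
  and then geometric.\<close>

lemma nn_integral_vec_power_finite:
  assumes "length \<alpha> = length d" "\<forall>a\<in>set \<alpha>. 0 \<le> a \<and> a < 1"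
  shows "(\<integral>\<^sup>+x. ennreal (vec_power \<alpha> (excess d x)) \<partial>count_space (vecs (length d))) < \<top>"
  using assms
proof (induction \<alpha> d rule: list_induct2)
  case Nil
  have vecs: "vecs (length []) = {[]}" by (auto simp: vecs_def)
  show ?case unfolding vecs by (subst nn_integral_count_space_finite) (simp_all add: excess_def)
next
  case (Cons a \<alpha> b d)
  have a: "0 \<le> a ^ j" for j using Cons.prems by simp
  let ?I = "\<integral>\<^sup>+x. ennreal (vec_power \<alpha> (excess d x)) \<partial>count_space (vecs (length d))"
  have "vec_power (a # \<alpha>) (excess (b # d) (j # x)) = a ^ (j + 1 - b) * vec_power \<alpha> (excess d x)" for j x
    by (simp add: excess_def)
  then have "(\<integral>\<^sup>+x. ennreal (vec_power (a # \<alpha>) (excess (b # d) x)) \<partial>count_space (vecs (length (b # d)))) =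
    (\<Sum>j. \<integral>\<^sup>+x. ennreal (a ^ (j + 1 - b)) * ennreal (vec_power \<alpha> (excess d x)) \<partial>count_space (vecs (length d)))"
    by (simp only: nn_integral_vecs_Cons length_Cons ennreal_mult'[OF a])
  also have "\<dots> = (\<Sum>j. ennreal (a ^ (j + 1 - b)) * ?I)"
    by (subst nn_integral_cmult) simp_all
  also have "\<dots> = (\<Sum>j. ennreal (a ^ (j + 1 - b))) * ?I"
    by (rule ennreal_suminf_multc)
  also have "\<dots> < \<top>"
  proof -
    have "?I < \<top>" using Cons.prems by (intro Cons.IH) auto
    moreover have "(\<Sum>j. ennreal (a ^ (j + 1 - b))) < \<top>"
      using Cons.prems by (intro suminf_power_excess_finite) auto
    ultimately show ?thesis unfolding ennreal_mult_less_top by blast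
  qed
  finally show ?case .
qed

definition egd_mass :: "nat \<Rightarrow> egd \<Rightarrow> ennreal" where
  "egd_mass n A = (\<integral>\<^sup>+x. ennreal (coeff_at A x) \<partial>count_space (vecs n))"

lemma egd_mass_finite:
  assumes "is_egd n A"
  shows "egd_mass n A < \<top>"
proof -
  obtain P \<alpha> where A: "A = (P, \<alpha>)" by force
  note D = is_egdD[OF assms[unfolded A]]
  \<comment> \<open>A uniform bound for the entries: each is at most the sum of all, since the box
    is finite and the entries are nonnegative.\<close>
  define K where "K = (\<Sum>i\<in>box (dims P). entry P i)"
  have K: "0 \<le> K" unfolding K_def using D by (intro sum_nonneg) auto
  have le: "coeff_at A x \<le> K * vec_power \<alpha> (excess (dims P) x)" if "x \<in> vecs n" for x
  proof -
    have "clamp_idx (dims P) x \<in> box (dims P)"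
      using that D by (intro clamp_idx_in_box) (auto simp: vecs_def)
    then have "entry P (clamp_idx (dims P) x) \<le> K"
      unfolding K_def using D finite_box by (intro member_le_sum) auto
    moreover have "0 \<le> vec_power \<alpha> (excess (dims P) x)" using that D by (intro vec_power_nonneg) (auto simp: vecs_def)
    ultimately show ?thesis unfolding A coeff_at_eq by (rule mult_right_mono)
  qed
  have "egd_mass n A \<le> (\<integral>\<^sup>+x. ennreal K * ennreal (vec_power \<alpha> (excess (dims P) x)) \<partial>count_space (vecs n))"
    unfolding egd_mass_def using K by (intro nn_integral_mono) (auto simp: ennreal_mult'[symmetric] intro!: ennreal_leI le)
  also have "\<dots> = ennreal K * (\<integral>\<^sup>+x. ennreal (vec_power \<alpha> (excess (dims P) x)) \<partial>count_space (vecs n))"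
    by (rule nn_integral_cmult) auto
  also have "\<dots> < \<top>"
  proof -
    have "\<forall>a\<in>set \<alpha>. 0 \<le> a \<and> a < 1" using D by (auto simp: in_set_conv_nth)
    then show ?thesis
      using nn_integral_vec_power_finite[of \<alpha> "dims P"] D by (simp add: ennreal_mult_less_top)
  qed
  finally show ?thesis .
qed

section \<open>Measures on program states\<close>

lemma suminf_swap_ennreal: "(\<Sum>i. \<Sum>j. f i j) = (\<Sum>j. \<Sum>i. f i j :: ennreal)"
  using nn_integral_suminf[of "\<lambda>j i. f i j" "count_space UNIV"]
  by (simp add: nn_integral_count_space_nat)

lemma sigma_sets_Pow [simp]: "sigma_sets A (Pow A) = Pow A"
  by (rule sigma_algebra.sigma_sets_eq[OF sigma_algebra_Pow])

lemma MeasD: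
  assumes "\<mu> \<in> Meas n"
  shows "sets \<mu> = Pow (states n)" "space \<mu> = states n" "\<And>S. S \<subseteq> states n \<Longrightarrow> S \<in> sets \<mu>"
    "f \<in> borel_measurable \<mu>"
proof -
  have s: "sets \<mu> = sets (count_space (states n))" using assms by (simp add: Meas_def)
  then show "sets \<mu> = Pow (states n)" "space \<mu> = states n" "\<And>S. S \<subseteq> states n \<Longrightarrow> S \<in> sets \<mu>"
    using sets_eq_imp_space_eq[OF s] by simp_all
  show "f \<in> borel_measurable \<mu>" unfolding measurable_cong_sets[OF s refl] by simp
qed

lemma mk_meas_in_Meas [simp]: "mk_meas n f \<in> Meas n"
  by (simp add: Meas_def)

text \<open>For set functions already known to agree with some measure, so that additivity need not
  be proved again.\<close>

lemma mk_meas_eqI: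
  assumes "M \<in> Meas n" "\<And>S. S \<subseteq> states n \<Longrightarrow> f S = emeasure M S"
  shows "mk_meas n f = M"
proof -
  have "mk_meas n f = mk_meas n (emeasure M)"
    using assms(2) by (intro measure_of_eq) auto
  also have "\<dots> = M" using measure_of_of_measure[of M] MeasD[OF assms(1)] by simp
  finally show ?thesis .
qed

text \<open>\<open>measure_of\<close> yields the zero measure when its set function is not countably
  additive. This is the condition under which \<open>mk_meas\<close> keeps the prescribed
  values.\<close>

definition is_mass :: "nat \<Rightarrow> (nat list option set \<Rightarrow> ennreal) \<Rightarrow> bool" where
  "is_mass n f \<longleftrightarrow> f {} = 0 \<and>
     (\<forall>A::nat \<Rightarrow> _. range A \<subseteq> Pow (states n) \<longrightarrow> disjoint_family A \<longrightarrow> (\<Sum>i. f (A i)) = f (\<Union>i. A i))"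

lemma emeasure_mk_meas:
  assumes "is_mass n f" "S \<subseteq> states n"
  shows "emeasure (mk_meas n f) S = f S"
proof (rule emeasure_measure_of[OF refl])
  show "positive (sets (mk_meas n f)) f" using assms by (simp add: positive_def is_mass_def)
  show "countably_additive (sets (mk_meas n f)) f"
    using assms by (intro countably_additiveI) (simp add: is_mass_def)
qed (use assms in auto)

lemma is_mass_emeasure_Int:
  assumes "\<mu> \<in> Meas n"
  shows "is_mass n (\<lambda>S. emeasure \<mu> (S \<inter> T))"
  unfolding is_mass_def
proof (intro conjI allI impI)
  fix A :: "nat \<Rightarrow> nat list option set"
  assume A: "range A \<subseteq> Pow (states n)" "disjoint_family A"
  have "(\<Sum>i. emeasure \<mu> (A i \<inter> T)) = emeasure \<mu> (\<Union>i. A i \<inter> T)"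
    using A MeasD(1)[OF assms] by (intro suminf_emeasure) (auto 0 3 simp: disjoint_family_on_def)
  then show "(\<Sum>i. emeasure \<mu> (A i \<inter> T)) = emeasure \<mu> ((\<Union>i. A i) \<inter> T)" by simp
qed simp

lemma is_mass_emeasure: "\<mu> \<in> Meas n \<Longrightarrow> is_mass n (emeasure \<mu>)"
  using is_mass_emeasure_Int[of \<mu> n UNIV] by simp

lemma is_mass_add: "is_mass n f \<Longrightarrow> is_mass n g \<Longrightarrow> is_mass n (\<lambda>S. f S + g S)"
  by (simp add: is_mass_def suminf_add[symmetric])

lemma is_mass_suminf: "(\<And>k::nat. is_mass n (f k)) \<Longrightarrow> is_mass n (\<lambda>S. \<Sum>k. f k S)"
  by (simp add: is_mass_def suminf_swap_ennreal[of "\<lambda>i k. f k (_ i)"])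

lemma singleton_state: "y \<in> vecs n \<Longrightarrow> {Some y} \<subseteq> states n"
  by (auto simp: states_def)

lemma restr_in_Meas [simp]: "restr n E \<mu> \<in> Meas n"
  by (induction E arbitrary: \<mu>) auto

lemma update_sem_in_Meas [simp]: "update_sem n f \<mu> \<in> Meas n"
  by (simp add: update_sem_def)

section \<open>Events as densities, assignments as image measures\<close>

definition event_density :: "event \<Rightarrow> nat list option \<Rightarrow> ennreal" where
  "event_density E s = (case s of None \<Rightarrow> 0 | Some x \<Rightarrow> ennreal (event_weight E x))"

lemma density_in_Meas: "\<mu> \<in> Meas n \<Longrightarrow> density \<mu> f \<in> Meas n"
  by (simp add: Meas_def)

text \<open>Restrictions compose by multiplying densities, and negation subtracts integrals; the
  latter needs a finite subtrahend. Finite mass off the failure state suffices, as every density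
  vanishes at \<open>None\<close>.\<close>

lemma restr_eq_density:
  assumes "\<mu> \<in> Meas n" "wf_event n E" "emeasure \<mu> (Some ` vecs n) < \<top>"
  shows "restr n E \<mu> = density \<mu> (event_density E)"
  using assms
proof (induction E arbitrary: \<mu>)
  case (VarEq k a)
  note M = MeasD[OF VarEq.prems(1)]
  show ?case unfolding restr.simps
  proof (rule mk_meas_eqI[OF density_in_Meas[OF VarEq.prems(1)]])
    fix S assume S: "S \<subseteq> states n"
    have "emeasure (density \<mu> (event_density (VarEq k a))) S =
        (\<integral>\<^sup>+s. event_density (VarEq k a) s * indicator S s \<partial>\<mu>)"
      using M S by (subst emeasure_density) auto
    also have "\<dots> = (\<integral>\<^sup>+s. indicator {s \<in> S. \<exists>x\<in>vecs n. s = Some x \<and> x ! k = a} s \<partial>\<mu>)"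
      using S M by (intro nn_integral_cong)
        (auto simp: event_density_def indicator_def states_def split: option.splits)
    also have "\<dots> = emeasure \<mu> {s \<in> S. \<exists>x\<in>vecs n. s = Some x \<and> x ! k = a}"
      using S by (intro nn_integral_indicator M(3)) auto
    finally show "emeasure \<mu> {s \<in> S. \<exists>x\<in>vecs n. s = Some x \<and> x ! k = a} =
      emeasure (density \<mu> (event_density (VarEq k a))) S" by simp
  qed
next
  case (Flip \<rho>)
  note M = MeasD[OF Flip.prems(1)]
  show ?case unfolding restr.simps
  proof (rule mk_meas_eqI[OF density_in_Meas[OF Flip.prems(1)]])
    fix S assume S: "S \<subseteq> states n"
    have "emeasure (density \<mu> (event_density (Flip \<rho>))) S =
        (\<integral>\<^sup>+s. event_density (Flip \<rho>) s * indicator S s \<partial>\<mu>)"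
      using M S by (subst emeasure_density) auto
    also have "\<dots> = (\<integral>\<^sup>+s. ennreal \<rho> * indicator (S \<inter> Some ` vecs n) s \<partial>\<mu>)"
      using S M by (intro nn_integral_cong)
        (auto simp: event_density_def indicator_def states_def split: option.splits)
    also have "\<dots> = ennreal \<rho> * emeasure \<mu> (S \<inter> Some ` vecs n)"
      using S by (intro nn_integral_cmult_indicator M(3)) auto
    finally show "ennreal \<rho> * emeasure \<mu> (S \<inter> Some ` vecs n) =
      emeasure (density \<mu> (event_density (Flip \<rho>))) S" by simp
  qed
next
  case (Neg E)
  note M = MeasD[OF Neg.prems(1)]
  have wf: "wf_event n E" using Neg.prems by simp
  show ?case unfolding restr.simps
  proof (rule mk_meas_eqI[OF density_in_Meas[OF Neg.prems(1)]])
    fix S assume S: "S \<subseteq> states n"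
    let ?V = "S \<inter> Some ` vecs n"
    have V: "?V \<in> sets \<mu>" using S by (intro M(3)) auto
    have w: "ennreal (event_weight E x) \<le> 1" for x using event_weight_bounds[OF wf, of x] by simp
    have r: "emeasure (restr n E \<mu>) S = (\<integral>\<^sup>+s. event_density E s * indicator S s \<partial>\<mu>)"
      using M S by (simp add: Neg.IH[OF Neg.prems(1) wf Neg.prems(3)] emeasure_density[OF M(4)])
    have le: "event_density E s * indicator S s \<le> indicator ?V s" if "s \<in> space \<mu>" for s
      using w that by (auto simp: event_density_def indicator_def M(2) states_def split: option.splits)
    have "(\<integral>\<^sup>+s. event_density E s * indicator S s \<partial>\<mu>) \<le> (\<integral>\<^sup>+s. indicator ?V s \<partial>\<mu>)"
      by (rule nn_integral_mono[OF le])
    also have "\<dots> = emeasure \<mu> ?V" using V by simp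
    also have "\<dots> \<le> emeasure \<mu> (Some ` vecs n)"
      by (intro emeasure_mono M(3)) (auto simp: states_def)
    \<comment> \<open>Excludes a difference of infinite integrals in \<open>nn_integral_diff\<close>
      below.\<close>
    finally have fin: "(\<integral>\<^sup>+s. event_density E s * indicator S s \<partial>\<mu>) \<noteq> \<infinity>"
      using Neg.prems(3) by auto
    have "emeasure (density \<mu> (event_density (Neg E))) S =
        (\<integral>\<^sup>+s. event_density (Neg E) s * indicator S s \<partial>\<mu>)"
      using M S by (subst emeasure_density) auto
    also have "\<dots> = (\<integral>\<^sup>+s. indicator ?V s - event_density E s * indicator S s \<partial>\<mu>)"
      using S M event_weight_bounds[OF wf]
      by (intro nn_integral_cong)
        (auto simp: event_density_def indicator_def states_def ennreal_minus[symmetric] split: option.splits)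
    also have "\<dots> = (\<integral>\<^sup>+s. indicator ?V s \<partial>\<mu>) - (\<integral>\<^sup>+s. event_density E s * indicator S s \<partial>\<mu>)"
      using fin le by (intro nn_integral_diff M(4) AE_I2)
    also have "(\<integral>\<^sup>+s. indicator ?V s \<partial>\<mu>) = emeasure \<mu> ?V" using V by simp
    finally show "emeasure \<mu> ?V - emeasure (restr n E \<mu>) S =
      emeasure (density \<mu> (event_density (Neg E))) S" by (simp add: r)
  qed
next
  case (Conj E1 E2)
  note M = MeasD[OF Conj.prems(1)]
  have wf: "wf_event n E1" "wf_event n E2" using Conj.prems by auto
  let ?d1 = "event_density E1" and ?d2 = "event_density E2"
  have r1: "restr n E1 \<mu> = density \<mu> ?d1" by (rule Conj.IH(1)[OF Conj.prems(1) wf(1) Conj.prems(3)])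
  have V: "Some ` vecs n \<in> sets \<mu>" by (intro M(3)) (auto simp: states_def)
  \<comment> \<open>Restriction by \<open>E1\<close> does not increase mass, so the measure stays
    finite and the induction hypothesis for \<open>E2\<close> applies to it.\<close>
  have w: "?d1 s \<le> 1" for s
    using event_weight_bounds[OF wf(1)] by (auto simp: event_density_def split: option.splits)
  have "emeasure (density \<mu> ?d1) (Some ` vecs n) = (\<integral>\<^sup>+s. ?d1 s * indicator (Some ` vecs n) s \<partial>\<mu>)"
    using V M(4) by (subst emeasure_density) auto
  also have "\<dots> \<le> (\<integral>\<^sup>+s. indicator (Some ` vecs n) s \<partial>\<mu>)"
    using w by (intro nn_integral_mono) (auto simp: indicator_def)
  also have "\<dots> < \<top>" using V Conj.prems(3) by simp
  finally have "restr n E2 (density \<mu> ?d1) = density (density \<mu> ?d1) ?d2"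
    by (rule Conj.IH(2)[OF density_in_Meas[OF Conj.prems(1)] wf(2)])
  also have "\<dots> = density \<mu> (\<lambda>s. ?d1 s * ?d2 s)"
    by (rule density_density_eq) (rule M(4))+
  also have "(\<lambda>s. ?d1 s * ?d2 s) = event_density (Conj E1 E2)"
    using event_weight_bounds[OF wf(1)]
    by (auto simp: event_density_def ennreal_mult' fun_eq_iff split: option.splits)
  finally show ?case by (simp add: r1)
qed

lemma restr_singleton:
  assumes "\<mu> \<in> Meas n" "wf_event n E" "emeasure \<mu> (Some ` vecs n) < \<top>" "y \<in> vecs n"
  shows "emeasure (restr n E \<mu>) {Some y} = ennreal (event_weight E y) * emeasure \<mu> {Some y}"
proof -
  note M = MeasD[OF assms(1)]
  have "{Some y} \<in> sets \<mu>" using assms(4) by (intro M(3) singleton_state)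
  then show ?thesis
    by (simp add: restr_eq_density[OF assms(1-3)] emeasure_density[OF M(4)] event_density_def)
qed

text \<open>The fibre over \<open>y\<close> consists of the states \<open>y[k := j]\<close> with
  \<open>g j = y ! k\<close>. It is written as a union over all \<open>j\<close>, padded with empty
  sets, so that countable additivity gives a series over the naturals.\<close>

lemma update_sem_singleton:
  assumes \<mu>: "\<mu> \<in> Meas n" and y: "y \<in> vecs n" and k: "k < n"
  shows "emeasure (update_sem n (\<lambda>x. x[k := g (x ! k)]) \<mu>) {Some y} =
    (\<Sum>j. if g j = y ! k then emeasure \<mu> {Some (y[k := j])} else 0)"
proof -
  note M = MeasD[OF \<mu>]
  define f where "f x = x[k := g (x ! k)]" for x :: "nat list"
  have f: "f x \<in> vecs n" if "x \<in> vecs n" for x using that by (simp add: f_def vecs_def)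
  have "is_mass n (\<lambda>S. emeasure \<mu> {Some x | x. x \<in> vecs n \<and> Some (f x) \<in> S})"
    unfolding is_mass_def
  proof (intro conjI allI impI)
    fix A :: "nat \<Rightarrow> nat list option set"
    assume A: "range A \<subseteq> Pow (states n)" "disjoint_family A"
    have "(\<Sum>i. emeasure \<mu> {Some x | x. x \<in> vecs n \<and> Some (f x) \<in> A i}) =
        emeasure \<mu> (\<Union>i. {Some x | x. x \<in> vecs n \<and> Some (f x) \<in> A i})"
      using A M by (intro suminf_emeasure) (fastforce simp: disjoint_family_on_def states_def)+
    also have "(\<Union>i. {Some x | x. x \<in> vecs n \<and> Some (f x) \<in> A i}) =
        {Some x | x. x \<in> vecs n \<and> Some (f x) \<in> (\<Union>i. A i)}" by auto
    finally show "(\<Sum>i. emeasure \<mu> {Some x | x. x \<in> vecs n \<and> Some (f x) \<in> A i}) =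
        emeasure \<mu> {Some x | x. x \<in> vecs n \<and> Some (f x) \<in> (\<Union>i. A i)}" .
  qed simp
  then have "emeasure (update_sem n f \<mu>) {Some y} =
      emeasure \<mu> ({Some y} \<inter> {None}) + emeasure \<mu> {Some x | x. x \<in> vecs n \<and> Some (f x) \<in> {Some y}}"
    unfolding update_sem_def
    by (intro emeasure_mk_meas is_mass_add is_mass_emeasure_Int \<mu> singleton_state y)
  also have "\<dots> = emeasure \<mu> {Some x | x. x \<in> vecs n \<and> f x = y}" by simp
  also have "{Some x | x. x \<in> vecs n \<and> f x = y} =
      (\<Union>j. if g j = y ! k then {Some (y[k := j])} else {})"
  proof (intro equalityI subsetI)
    fix s assume "s \<in> {Some x | x. x \<in> vecs n \<and> f x = y}"
    then obtain x where x: "s = Some x" "x \<in> vecs n" "f x = y" by auto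
    then have "g (x ! k) = y ! k" "x = y[k := x ! k]" using k by (auto simp: f_def vecs_def)
    then show "s \<in> (\<Union>j. if g j = y ! k then {Some (y[k := j])} else {})"
      using x by (auto intro!: exI[of _ "x ! k"])
  next
    fix s assume "s \<in> (\<Union>j. if g j = y ! k then {Some (y[k := j])} else {})"
    then obtain j where j: "g j = y ! k" "s = Some (y[k := j])" by (auto split: if_splits)
    then have "f (y[k := j]) = y" using y k by (simp add: f_def vecs_def)
    then show "s \<in> {Some x | x. x \<in> vecs n \<and> f x = y}" using j y by (auto simp: vecs_def)
  qed
  also have "emeasure \<mu> \<dots> = (\<Sum>j. emeasure \<mu> (if g j = y ! k then {Some (y[k := j])} else {}))"
  proof (rule suminf_emeasure[symmetric])
    show "range (\<lambda>j. if g j = y ! k then {Some (y[k := j])} else {}) \<subseteq> sets \<mu>"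
      using y M(1) by (auto simp: states_def vecs_def)
    have "i = j" if "y[k := i] = y[k := j]" for i j
      using arg_cong[OF that, of "\<lambda>x. x ! k"] y k by (simp add: vecs_def)
    then show "disjoint_family (\<lambda>j. if g j = y ! k then {Some (y[k := j])} else {})"
      by (auto simp: disjoint_family_on_def)
  qed
  also have "\<dots> = (\<Sum>j. if g j = y ! k then emeasure \<mu> {Some (y[k := j])} else 0)"
    by (intro suminf_cong) simp
  finally show ?thesis by (simp add: f_def[abs_def])
qed

section \<open>Loops as series over their iterations\<close>

lemma meas_le_antisym: "\<mu> \<preceq> \<nu> \<Longrightarrow> \<nu> \<preceq> \<mu> \<Longrightarrow> \<mu> = \<nu>"
  by (intro measure_eqI) (auto simp: meas_le_def intro: antisym)

text \<open>Two least fixed points bound each other on \<open>Meas n\<close>, and extensionality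
  makes them agree elsewhere.\<close>

lemma the_least_fp:
  assumes "is_least_fp n \<Phi> \<psi>"
  shows "(THE \<psi>. is_least_fp n \<Phi> \<psi>) = \<psi>"
proof (rule the_equality, rule assms)
  fix \<psi>' assume a: "is_least_fp n \<Phi> \<psi>'"
  show "\<psi>' = \<psi>"
  proof (rule PiE_ext)
    show "\<psi>' \<in> Meas n \<rightarrow>\<^sub>E Meas n" "\<psi> \<in> Meas n \<rightarrow>\<^sub>E Meas n"
      using a assms unfolding is_least_fp_def by blast+
    fix \<mu> assume "\<mu> \<in> Meas n"
    then show "\<psi>' \<mu> = \<psi> \<mu>"
      using a assms unfolding is_least_fp_def by (intro meas_le_antisym) blast+
  qed
qed

text \<open>The loop operator is affine: the mass \<open>a\<close> that leaves now plus the value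
  after one pass \<open>F\<close>. Unfolding it forever gives the series, a fixed point by an index
  shift. No chain argument or continuity of the operator is needed for leastness.\<close>

lemma is_least_fp_series:
  assumes a: "\<And>\<mu>. \<mu> \<in> Meas n \<Longrightarrow> is_mass n (a \<mu>)" and F: "\<And>\<mu>. \<mu> \<in> Meas n \<Longrightarrow> F \<mu> \<in> Meas n"
  shows "is_least_fp n (\<lambda>\<psi> \<mu>. mk_meas n (\<lambda>S. a \<mu> S + emeasure (\<psi> (F \<mu>)) S))
    (\<lambda>\<mu>\<in>Meas n. mk_meas n (\<lambda>S. \<Sum>k. a ((F ^^ k) \<mu>) S))"
proof -
  have Fk: "(F ^^ k) \<mu> \<in> Meas n" if "\<mu> \<in> Meas n" for k \<mu>
    using that by (induction k) (auto intro: F)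
  have mass: "is_mass n (\<lambda>S. \<Sum>k. a ((F ^^ k) \<mu>) S)" if "\<mu> \<in> Meas n" for \<mu>
    by (intro is_mass_suminf a Fk that)
  let ?\<psi> = "\<lambda>\<mu>\<in>Meas n. mk_meas n (\<lambda>S. \<Sum>k. a ((F ^^ k) \<mu>) S)"
  have fp: "mk_meas n (\<lambda>S. a \<mu> S + emeasure (?\<psi> (F \<mu>)) S) = ?\<psi> \<mu>" if \<mu>: "\<mu> \<in> Meas n" for \<mu>
  proof (rule mk_meas_eqI)
    show "?\<psi> \<mu> \<in> Meas n" using \<mu> by simp
    fix S assume S: "S \<subseteq> states n"
    have "emeasure (?\<psi> (F \<mu>)) S = (\<Sum>k. a ((F ^^ k) (F \<mu>)) S)"
      using emeasure_mk_meas[OF mass S] F[OF \<mu>] by simp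
    also have "\<dots> = (\<Sum>k. a ((F ^^ Suc k) \<mu>) S)" by (simp add: funpow_swap1)
    finally have "a \<mu> S + emeasure (?\<psi> (F \<mu>)) S = (\<Sum>k. a ((F ^^ k) \<mu>) S)"
      by (subst suminf_offset[of "\<lambda>k. a ((F ^^ k) \<mu>) S" 1]) auto
    then show "a \<mu> S + emeasure (?\<psi> (F \<mu>)) S = emeasure (?\<psi> \<mu>) S"
      using emeasure_mk_meas[OF mass S] \<mu> by simp
  qed
  have least: "?\<psi> \<mu> \<preceq> \<psi>' \<mu>"
    if \<psi>': "\<psi>' \<in> Meas n \<rightarrow>\<^sub>E Meas n" "\<forall>\<mu>\<in>Meas n. mk_meas n (\<lambda>S. a \<mu> S + emeasure (\<psi>' (F \<mu>)) S) = \<psi>' \<mu>"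
      and \<mu>: "\<mu> \<in> Meas n" for \<psi>' \<mu>
    unfolding meas_le_def
  proof (intro conjI ballI)
    have \<psi>'M: "\<psi>' \<nu> \<in> Meas n" if "\<nu> \<in> Meas n" for \<nu> using \<psi>'(1) that by auto
    show "sets (?\<psi> \<mu>) = sets (\<psi>' \<mu>)"
      using \<mu> MeasD(1)[OF \<psi>'M[OF \<mu>]] by simp
    fix S assume "S \<in> sets (?\<psi> \<mu>)"
    then have S: "S \<subseteq> states n" using \<mu> by simp
    have step: "emeasure (\<psi>' \<nu>) S = a \<nu> S + emeasure (\<psi>' (F \<nu>)) S" if "\<nu> \<in> Meas n" for \<nu>
      using emeasure_mk_meas[OF is_mass_add[OF a[OF that] is_mass_emeasure[OF \<psi>'M[OF F[OF that]]]] S]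
        \<psi>'(2) that by simp
    \<comment> \<open>Any fixed point equals its own \<open>m\<close>-fold unfolding; dropping the
      nonnegative remainder bounds all partial sums.\<close>
    have "(\<Sum>k<m. a ((F ^^ k) \<mu>) S) + emeasure (\<psi>' ((F ^^ m) \<mu>)) S = emeasure (\<psi>' \<mu>) S" for m
    proof (induction m)
      case (Suc m)
      then show ?case using step[OF Fk[OF \<mu>, of m]] by (simp add: add.assoc)
    qed simp
    then have "(\<Sum>k<m. a ((F ^^ k) \<mu>) S) \<le> emeasure (\<psi>' \<mu>) S" for m
      by (metis le_iff_add)
    then have "(\<Sum>k. a ((F ^^ k) \<mu>) S) \<le> emeasure (\<psi>' \<mu>) S"
      by (intro suminf_le_const summableI)
    then show "emeasure (?\<psi> \<mu>) S \<le> emeasure (\<psi>' \<mu>) S"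
      using emeasure_mk_meas[OF mass[OF \<mu>] S] \<mu> by simp
  qed
  show ?thesis
    unfolding is_least_fp_def using fp least by auto
qed

definition loop_step :: "nat \<Rightarrow> event \<Rightarrow> prog \<Rightarrow> nat list option measure \<Rightarrow> nat list option measure" where
  "loop_step n E B \<mu> = sem n B (restr n E \<mu>)"

text \<open>The series for a loop needs a body that preserves \<open>Meas n\<close>, while
  preservation for loops needs the series. So the series is derived with preservation by the body as
  a hypothesis, which the induction then supplies.\<close>

lemma sem_in_Meas: "\<mu> \<in> Meas n \<Longrightarrow> sem n P \<mu> \<in> Meas n"
  and emeasure_sem_While: "(\<And>\<mu>. \<mu> \<in> Meas n \<Longrightarrow> sem n B \<mu> \<in> Meas n) \<Longrightarrow> \<mu> \<in> Meas n \<Longrightarrow> S \<subseteq> states n \<Longrightarrow>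
    emeasure (sem n (While E B) \<mu>) S = (\<Sum>k. emeasure ((loop_step n E B ^^ k) \<mu>) (S \<inter> {None})
        + emeasure (restr n (Neg E) ((loop_step n E B ^^ k) \<mu>)) S)"
proof -
  have W: "sem n (While E B) = (\<lambda>\<mu>\<in>Meas n. mk_meas n (\<lambda>S. \<Sum>k. emeasure ((loop_step n E B ^^ k) \<mu>) (S \<inter> {None})
        + emeasure (restr n (Neg E) ((loop_step n E B ^^ k) \<mu>)) S))"
    if "\<And>\<mu>. \<mu> \<in> Meas n \<Longrightarrow> sem n B \<mu> \<in> Meas n" for E B
    unfolding sem.simps
    by (rule the_least_fp, unfold loop_step_def[symmetric], rule is_least_fp_series)
      (auto intro!: is_mass_add is_mass_emeasure_Int is_mass_emeasure that simp: loop_step_def simp del: restr.simps)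
  show "sem n P \<mu> \<in> Meas n" if "\<mu> \<in> Meas n" for P \<mu>
    using that
  proof (induction P arbitrary: \<mu>)
    case (While E B)
    show ?case using While.prems by (subst W[OF While.IH]) simp_all
  qed auto
  show "emeasure (sem n (While E B) \<mu>) S = (\<Sum>k. emeasure ((loop_step n E B ^^ k) \<mu>) (S \<inter> {None})
        + emeasure (restr n (Neg E) ((loop_step n E B ^^ k) \<mu>)) S)"
    if B: "\<And>\<mu>. \<mu> \<in> Meas n \<Longrightarrow> sem n B \<mu> \<in> Meas n" and \<mu>: "\<mu> \<in> Meas n" and S: "S \<subseteq> states n" for B \<mu> S
  proof -
    have "(loop_step n E B ^^ k) \<mu> \<in> Meas n" for k
      using \<mu> by (induction k) (auto simp: loop_step_def intro!: B)
    then have "is_mass n (\<lambda>S. \<Sum>k. emeasure ((loop_step n E B ^^ k) \<mu>) (S \<inter> {None})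
        + emeasure (restr n (Neg E) ((loop_step n E B ^^ k) \<mu>)) S)"
      by (intro is_mass_suminf is_mass_add is_mass_emeasure_Int is_mass_emeasure restr_in_Meas)
    from emeasure_mk_meas[OF this S] show ?thesis using W[OF B] \<mu> by simp
  qed
qed

section \<open>Exponentially weighted running time\<close>

text \<open>Generating function, at \<open>z\<close>, of the clock on the outcomes with final state
  \<open>x\<close>, not normalised. Failure does not contribute.\<close>

definition time_weight :: "real \<Rightarrow> nat list option measure \<Rightarrow> nat list \<Rightarrow> ennreal" where
  "time_weight z \<mu> x = (\<Sum>t. ennreal z ^ t * emeasure \<mu> {Some (x @ [t])})"

text \<open>The factor \<open>C\<close> stays outside the EGD: a single derivation starting at
  \<open>A\<close> then serves for all multiples of \<open>A\<close>, as the iterates of a loop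
  require.\<close>

definition time_le :: "nat \<Rightarrow> real \<Rightarrow> nat list option measure \<Rightarrow> ennreal \<Rightarrow> egd \<Rightarrow> bool" where
  "time_le n z \<mu> C A \<longleftrightarrow> (\<forall>x\<in>vecs n. time_weight z \<mu> x \<le> C * ennreal (coeff_at A x))"

lemma in_vecs_iff: "x \<in> vecs n \<longleftrightarrow> length x = n"
  by (simp add: vecs_def)

lemma snoc_in_vecs: "x \<in> vecs n \<Longrightarrow> x @ [t] \<in> vecs (Suc n)"
  by (simp add: vecs_def)

lemma emeasure_Some_vecs:
  assumes "\<mu> \<in> Meas n" "S \<subseteq> vecs n"
  shows "emeasure \<mu> (Some ` S) = (\<integral>\<^sup>+y. emeasure \<mu> {Some y} * indicator S y \<partial>count_space (vecs n))"
proof -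
  have c: "countable S" using assms(2) countable_vecs countable_subset by blast
  have "emeasure \<mu> (Some ` S) = (\<integral>\<^sup>+s. emeasure \<mu> {s} \<partial>count_space (Some ` S))"
    using assms MeasD(3)[OF assms(1)] c
    by (intro emeasure_countable_singleton) (auto simp: states_def)
  also have "\<dots> = (\<integral>\<^sup>+y. emeasure \<mu> {Some y} \<partial>count_space S)"
    by (intro nn_integral_bij_count_space[symmetric]) (auto simp: bij_betw_def)
  also have "\<dots> = (\<integral>\<^sup>+y. emeasure \<mu> {Some y} * indicator S y \<partial>count_space (vecs n))"
    using assms(2) by (simp add: nn_integral_count_space_indicator[of S] nn_integral_count_space_indicator[of "vecs n"]
        mult.assoc indicator_inter_arith[symmetric] Int_absorb2)
  finally show ?thesis .
qed

text \<open>Weights \<open>z ^ t\<close> are at least 1, so the unweighted mass is at most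
  \<open>C\<close> times the total mass of the EGD. This provides the finiteness that
  \<open>restr_eq_density\<close> asks for.\<close>

lemma time_le_finite:
  assumes \<mu>: "\<mu> \<in> Meas (Suc n)" and z: "1 < z" and C: "C < \<top>" and A: "is_egd n A"
    and le: "time_le n z \<mu> C A"
  shows "emeasure \<mu> (Some ` vecs (Suc n)) < \<top>"
proof -
  have z1: "1 \<le> ennreal z ^ t" for t using z by (intro one_le_power) simp
  have "emeasure \<mu> (Some ` vecs (Suc n)) = (\<integral>\<^sup>+y. emeasure \<mu> {Some y} \<partial>count_space (vecs (Suc n)))"
    by (subst emeasure_Some_vecs[OF \<mu> order_refl]) (auto intro!: nn_integral_cong)
  also have "\<dots> = (\<integral>\<^sup>+x. (\<Sum>t. emeasure \<mu> {Some (x @ [t])}) \<partial>count_space (vecs n))"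
    by (rule nn_integral_vecs_snoc)
  also have "\<dots> \<le> (\<integral>\<^sup>+x. C * ennreal (coeff_at A x) \<partial>count_space (vecs n))"
  proof (rule nn_integral_mono)
    fix x assume x: "x \<in> space (count_space (vecs n))"
    have "(\<Sum>t. emeasure \<mu> {Some (x @ [t])}) \<le> time_weight z \<mu> x"
      unfolding time_weight_def using mult_right_mono[OF z1] by (intro suminf_le) auto
    also have "\<dots> \<le> C * ennreal (coeff_at A x)" using le x by (simp add: time_le_def)
    finally show "(\<Sum>t. emeasure \<mu> {Some (x @ [t])}) \<le> C * ennreal (coeff_at A x)" .
  qed
  also have "\<dots> = C * egd_mass n A" unfolding egd_mass_def by (rule nn_integral_cmult) simp
  also have "\<dots> < \<top>" using C egd_mass_finite[OF A] by (simp add: ennreal_mult_less_top)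
  finally show ?thesis .
qed

lemma time_weight_restr:
  assumes \<mu>: "\<mu> \<in> Meas (Suc n)" and fin: "emeasure \<mu> (Some ` vecs (Suc n)) < \<top>"
    and wf: "wf_event n E" and x: "x \<in> vecs n"
  shows "time_weight z (restr (Suc n) E \<mu>) x = ennreal (event_weight E x) * time_weight z \<mu> x"
proof -
  have "event_weight E (x @ [t]) = event_weight E x" for t
    using event_weight_append[OF wf] x by (simp add: vecs_def)
  then have "emeasure (restr (Suc n) E \<mu>) {Some (x @ [t])} = ennreal (event_weight E x) * emeasure \<mu> {Some (x @ [t])}" for t
    using restr_singleton[OF \<mu> wf_event_Suc[OF wf] fin snoc_in_vecs[OF x]] by simp
  then show ?thesis
    unfolding time_weight_def by (simp add: mult.left_commute[of _ "ennreal (event_weight E x)"])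
qed

lemma time_weight_update:
  assumes \<mu>: "\<mu> \<in> Meas (Suc n)" and x: "x \<in> vecs n" and k: "k < n"
  shows "time_weight z (update_sem (Suc n) (\<lambda>x. x[k := g (x ! k)]) \<mu>) x =
    (\<Sum>j. if g j = x ! k then time_weight z \<mu> (x[k := j]) else 0)"
proof -
  have "emeasure (update_sem (Suc n) (\<lambda>x. x[k := g (x ! k)]) \<mu>) {Some (x @ [t])} =
      (\<Sum>j. if g j = x ! k then emeasure \<mu> {Some (x[k := j] @ [t])} else 0)" for t
    using update_sem_singleton[OF \<mu> snoc_in_vecs[OF x], of k g t] k x
    by (simp add: nth_append list_update_append vecs_def cong: if_cong)
  then have "time_weight z (update_sem (Suc n) (\<lambda>x. x[k := g (x ! k)]) \<mu>) x =
      (\<Sum>t. \<Sum>j. ennreal z ^ t * (if g j = x ! k then emeasure \<mu> {Some (x[k := j] @ [t])} else 0))"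
    by (simp add: time_weight_def)
  also have "\<dots> = (\<Sum>j. \<Sum>t. ennreal z ^ t * (if g j = x ! k then emeasure \<mu> {Some (x[k := j] @ [t])} else 0))"
    by (rule suminf_swap_ennreal)
  also have "\<dots> = (\<Sum>j. if g j = x ! k then time_weight z \<mu> (x[k := j]) else 0)"
    by (intro suminf_cong) (simp add: time_weight_def)
  finally show ?thesis .
qed

text \<open>A clock value \<open>t\<close> after the tick stems from \<open>t - 1\<close>, and 0 has
  no origin; the shift multiplies a generating function by its argument.\<close>

lemma time_weight_tick:
  assumes \<mu>: "\<mu> \<in> Meas (Suc n)" and x: "x \<in> vecs n"
  shows "time_weight z (sem (Suc n) (Incr n 1) \<mu>) x = ennreal z * time_weight z \<mu> x"
proof -
  have e: "emeasure (sem (Suc n) (Incr n 1) \<mu>) {Some (x @ [t])} =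
      (\<Sum>j. if t = j + 1 then emeasure \<mu> {Some (x @ [j])} else 0)" for t
    using update_sem_singleton[OF \<mu> snoc_in_vecs[OF x], of n "\<lambda>j. j + 1" t] x
    by (simp add: vecs_def list_update_append nth_append eq_commute[of t] cong: if_cong)
  have "time_weight z (sem (Suc n) (Incr n 1) \<mu>) x =
      (\<Sum>t. \<Sum>j. if t = j + 1 then ennreal z ^ t * emeasure \<mu> {Some (x @ [j])} else 0)"
    unfolding time_weight_def e ennreal_suminf_cmult[symmetric] by (intro suminf_cong) simp
  also have "\<dots> = (\<Sum>j. \<Sum>t. if t = j + 1 then ennreal z ^ t * emeasure \<mu> {Some (x @ [j])} else 0)"
    by (rule suminf_swap_ennreal)
  also have "\<dots> = (\<Sum>j. ennreal z * (ennreal z ^ j * emeasure \<mu> {Some (x @ [j])}))"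
    unfolding suminf_indicator_ennreal by (simp add: mult.assoc)
  also have "\<dots> = ennreal z * time_weight z \<mu> x"
    by (simp add: time_weight_def)
  finally show ?thesis .
qed

lemma time_le_restr:
  assumes \<mu>: "\<mu> \<in> Meas (Suc n)" and z: "1 < z" and C: "C < \<top>" and A: "is_egd n A"
    and le: "time_le n z \<mu> C A" and wf: "wf_event n E"
  shows "time_le n z (restr (Suc n) E \<mu>) C (geo_event E A)"
  unfolding time_le_def
proof
  fix x assume x: "x \<in> vecs n"
  have "time_weight z (restr (Suc n) E \<mu>) x = ennreal (event_weight E x) * time_weight z \<mu> x"
    by (rule time_weight_restr[OF \<mu> time_le_finite[OF \<mu> z C A le] wf x])
  also have "\<dots> \<le> ennreal (event_weight E x) * (C * ennreal (coeff_at A x))"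
    using le x by (intro mult_left_mono) (auto simp: time_le_def)
  also have "\<dots> = C * ennreal (event_weight E x * coeff_at A x)"
    unfolding ennreal_mult'[OF event_weight_bounds(1)[OF wf]] by (rule mult.left_commute)
  also have "event_weight E x * coeff_at A x = coeff_at (geo_event E A) x"
    using coeff_at_geo_event[OF A wf] x by (simp add: in_vecs_iff)
  finally show "time_weight z (restr (Suc n) E \<mu>) x \<le> C * ennreal (coeff_at (geo_event E A) x)" .
qed

lemma time_le_mono:
  assumes le: "time_le n z \<mu> C A" and AB: "\<And>x. length x = n \<Longrightarrow> coeff_at A x \<le> coeff_at B x"
  shows "time_le n z \<mu> C B"
  unfolding time_le_def
proof
  fix x assume x: "x \<in> vecs n"
  then have "time_weight z \<mu> x \<le> C * ennreal (coeff_at A x)" using le by (simp add: time_le_def)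
  also have "\<dots> \<le> C * ennreal (coeff_at B x)"
    using AB x by (intro mult_left_mono ennreal_leI) (auto simp: in_vecs_iff)
  finally show "time_weight z \<mu> x \<le> C * ennreal (coeff_at B x)" .
qed

lemma time_le_update:
  assumes \<mu>: "\<mu> \<in> Meas (Suc n)" and le: "time_le n z \<mu> C A" and k: "k < n"
    and AB: "\<And>x. length x = n \<Longrightarrow>
      (\<Sum>j. if g j = x ! k then ennreal (coeff_at A (x[k := j])) else 0) \<le> ennreal (coeff_at B x)"
  shows "time_le n z (update_sem (Suc n) (\<lambda>x. x[k := g (x ! k)]) \<mu>) C B"
  unfolding time_le_def
proof
  fix x assume x: "x \<in> vecs n"
  have "time_weight z (update_sem (Suc n) (\<lambda>x. x[k := g (x ! k)]) \<mu>) x =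
      (\<Sum>j. if g j = x ! k then time_weight z \<mu> (x[k := j]) else 0)"
    by (rule time_weight_update[OF \<mu> x k])
  also have "\<dots> \<le> (\<Sum>j. C * (if g j = x ! k then ennreal (coeff_at A (x[k := j])) else 0))"
    using le x by (intro suminf_le summableI) (auto simp: time_le_def vecs_def)
  also have "\<dots> \<le> C * ennreal (coeff_at B x)"
    using AB x by (simp add: mult_left_mono in_vecs_iff)
  finally show "time_weight z (update_sem (Suc n) (\<lambda>x. x[k := g (x ! k)]) \<mu>) x \<le> C * ennreal (coeff_at B x)" .
qed

lemma time_le_tick:
  assumes \<mu>: "\<mu> \<in> Meas (Suc n)" and le: "time_le n z \<mu> C A" and z: "z \<le> q"
  shows "time_le n z (sem (Suc n) (Incr n 1) \<mu>) (ennreal q * C) A"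
  unfolding time_le_def
proof
  fix x assume x: "x \<in> vecs n"
  have "time_weight z (sem (Suc n) (Incr n 1) \<mu>) x = ennreal z * time_weight z \<mu> x"
    by (rule time_weight_tick[OF \<mu> x])
  also have "\<dots> \<le> ennreal q * (C * ennreal (coeff_at A x))"
    using le x z by (intro mult_mono ennreal_leI) (auto simp: time_le_def)
  finally show "time_weight z (sem (Suc n) (Incr n 1) \<mu>) x \<le> ennreal q * C * ennreal (coeff_at A x)"
    by (simp add: mult.assoc)
qed

section \<open>Induction on the program\<close>

text \<open>\<open>q\<close> is the total price of all ticks in a run of \<open>P\<close>, at the
  fixed weight \<open>z\<close>. Quantifying over all measures and all finite \<open>C\<close> makes
  the statement reusable in every pass of a loop.\<close>

definition slowdown_le :: "nat \<Rightarrow> prog \<Rightarrow> egd \<Rightarrow> egd \<Rightarrow> real \<Rightarrow> real \<Rightarrow> bool" where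
  "slowdown_le n P A B q z \<longleftrightarrow> (\<forall>\<mu>\<in>Meas (Suc n). \<forall>C<\<top>. time_le n z \<mu> C A \<longrightarrow>
     time_le n z (sem (Suc n) (timed n P) \<mu>) (ennreal q * C) B)"

lemma slowdown_leD:
  "slowdown_le n P A B q z \<Longrightarrow> \<mu> \<in> Meas (Suc n) \<Longrightarrow> C < \<top> \<Longrightarrow> time_le n z \<mu> C A \<Longrightarrow>
     time_le n z (sem (Suc n) (timed n P) \<mu>) (ennreal q * C) B"
  by (simp add: slowdown_le_def)

text \<open>Tests take no time, and the branches start from complementary parts of one measure; both
  can therefore use the full slack \<open>q\<close>.\<close>

lemma slowdown_le_If:
  assumes A: "is_egd n A" and R: "is_egd n R" and S: "is_egd n S" and j: "egd_join R S B"
    and wf: "wf_event n E" and z: "1 < z"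
    and 1: "slowdown_le n P1 (geo_event E A) R q z" and 2: "slowdown_le n P2 (geo_event (Neg E) A) S q z"
  shows "slowdown_le n (If E P1 P2) A B q z"
  unfolding slowdown_le_def
proof (intro ballI allI impI)
  fix \<mu> C assume \<mu>: "\<mu> \<in> Meas (Suc n)" and C: "C < (\<top>::ennreal)" and le: "time_le n z \<mu> C A"
  define \<mu>1 where "\<mu>1 = sem (Suc n) (timed n P1) (restr (Suc n) E \<mu>)"
  define \<mu>2 where "\<mu>2 = sem (Suc n) (timed n P2) (restr (Suc n) (Neg E) \<mu>)"
  define \<nu> where "\<nu> = sem (Suc n) (timed n (If E P1 P2)) \<mu>"
  have M: "\<mu>1 \<in> Meas (Suc n)" "\<mu>2 \<in> Meas (Suc n)"
    unfolding \<mu>1_def \<mu>2_def by (intro sem_in_Meas restr_in_Meas)+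
  have wf': "wf_event n (Neg E)" using wf by simp
  have l1: "time_le n z \<mu>1 (ennreal q * C) R"
    unfolding \<mu>1_def by (rule slowdown_leD[OF 1 restr_in_Meas C time_le_restr[OF \<mu> z C A le wf]])
  have l2: "time_le n z \<mu>2 (ennreal q * C) S"
    unfolding \<mu>2_def by (rule slowdown_leD[OF 2 restr_in_Meas C time_le_restr[OF \<mu> z C A le wf']])
  have \<nu>: "emeasure \<nu> {Some y} = emeasure \<mu>1 {Some y} + emeasure \<mu>2 {Some y}" if y: "y \<in> vecs (Suc n)" for y
  proof -
    have "emeasure \<nu> {Some y} = emeasure \<mu> ({Some y} \<inter> {None}) + emeasure \<mu>1 {Some y} + emeasure \<mu>2 {Some y}"
      unfolding \<nu>_def timed.simps sem.simps \<mu>1_def[symmetric] \<mu>2_def[symmetric]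
      by (intro emeasure_mk_meas is_mass_add is_mass_emeasure_Int is_mass_emeasure \<mu> M singleton_state y)
    then show ?thesis by simp
  qed
  show "time_le n z (sem (Suc n) (timed n (If E P1 P2)) \<mu>) (ennreal q * C) B"
    unfolding time_le_def \<nu>_def[symmetric]
  proof
    fix x assume x: "x \<in> vecs n"
    have "time_weight z \<nu> x = time_weight z \<mu>1 x + time_weight z \<mu>2 x"
      unfolding time_weight_def \<nu>[OF snoc_in_vecs[OF x]] distrib_left
      by (rule suminf_add[symmetric]) (rule summableI)+
    also have "\<dots> \<le> ennreal q * C * ennreal (coeff_at R x) + ennreal q * C * ennreal (coeff_at S x)"
      using l1 l2 x by (intro add_mono) (auto simp: time_le_def)
    also have "\<dots> = ennreal q * C * ennreal (coeff_at R x + coeff_at S x)"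
      using coeff_at_nonneg[OF R] coeff_at_nonneg[OF S] x by (simp add: distrib_left in_vecs_iff)
    also have "\<dots> \<le> ennreal q * C * ennreal (coeff_at B x)"
      using coeff_at_join[OF R S j] x by (intro mult_left_mono ennreal_leI) (auto simp: in_vecs_iff)
    finally show "time_weight z \<nu> x \<le> ennreal q * C * ennreal (coeff_at B x)" .
  qed
qed

lemma suminf_geometric_ennreal:
  assumes "0 \<le> c" "c < 1"
  shows "(\<Sum>k. ennreal c ^ k) = ennreal (1 / (1 - c))"
  using suminf_geometric[of c] summable_geometric[of c] assms
  by (simp add: ennreal_power suminf_ennreal2)

text \<open>A body of price \<open>q'\<close> turns the contraction \<open>c\<close> into
  \<open>c * q'\<close>, so the exits of all passes sum to \<open>1 / (1 - c * q')\<close> times the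
  exit part of the invariant. The bound \<open>Q\<close> already contains
  \<open>1 / (1 - c)\<close>, and the third assumption on \<open>q\<close> pays the
  difference.\<close>

lemma slowdown_le_While:
  assumes A: "is_egd n A" and R: "is_egd n (R, \<gamma>)" and S: "is_egd n S"
    and c: "0 \<le> c" "c < 1" and wf: "wf_event n E" and z: "1 < z"
    and AR: "egd_le A (R, \<gamma>)" and SR: "egd_le S (scale_tensor c R, \<gamma>)"
    and q: "0 \<le> q'" "c * q' < 1" "1 / (1 - c * q') \<le> q / (1 - c)"
    and body: "slowdown_le n B (geo_event E (R, \<gamma>)) S q' z"
    and Q: "geo_event (Neg E) (scale_tensor (1 / (1 - c)) R, \<gamma>) = Q"
  shows "slowdown_le n (While E B) A Q q z"
  unfolding slowdown_le_def
proof (intro ballI allI impI)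
  fix \<mu> C assume \<mu>: "\<mu> \<in> Meas (Suc n)" and C: "C < (\<top>::ennreal)" and le: "time_le n z \<mu> C A"
  define F where "F = loop_step (Suc n) E (timed n B)"
  have F: "F \<mu>' = sem (Suc n) (timed n B) (restr (Suc n) E \<mu>')" for \<mu>'
    by (simp add: F_def loop_step_def)
  define c' where "c' = c * q'"
  have c': "0 \<le> c'" "c' < 1" using c q by (auto simp: c'_def)
  have wf': "wf_event n (Neg E)" using wf by simp
  have Fk: "(F ^^ k) \<mu> \<in> Meas (Suc n)" for k
    using \<mu> by (cases k) (auto simp: F_def loop_step_def intro!: sem_in_Meas)
  have Ck: "ennreal c' ^ k * C < \<top>" for k
    using C c'(1) by (simp add: ennreal_mult_less_top ennreal_power)
  \<comment> \<open>Loop invariant: each pass costs \<open>q'\<close> and gains \<open>c\<close>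
    from \<open>SR\<close>; the gain is moved from the tensor into the constant.\<close>
  have inv: "time_le n z ((F ^^ k) \<mu>) (ennreal c' ^ k * C) (R, \<gamma>)" for k
  proof (induction k)
    case 0
    show ?case using time_le_mono[OF le coeff_at_mono[OF A R AR]] by simp
  next
    case (Suc k)
    have "time_le n z (F ((F ^^ k) \<mu>)) (ennreal q' * (ennreal c' ^ k * C)) S"
      by (subst F) (rule slowdown_leD[OF body restr_in_Meas Ck time_le_restr[OF Fk z Ck R Suc wf]])
    then have "time_le n z (F ((F ^^ k) \<mu>)) (ennreal q' * (ennreal c' ^ k * C)) (scale_tensor c R, \<gamma>)"
      by (rule time_le_mono) (rule coeff_at_mono[OF S is_egd_scale_tensor[OF R c(1)] SR])
    then show ?case
      using q(1) c(1) unfolding time_le_def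
      by (simp add: coeff_at_scale_tensor[OF R] in_vecs_iff c'_def ennreal_mult' mult_ac)
  qed
  define \<nu> where "\<nu> = sem (Suc n) (timed n (While E B)) \<mu>"
  have \<nu>: "emeasure \<nu> {Some y} = (\<Sum>k. emeasure (restr (Suc n) (Neg E) ((F ^^ k) \<mu>)) {Some y})"
    if y: "y \<in> vecs (Suc n)" for y
  proof -
    have "emeasure \<nu> {Some y} = (\<Sum>k. emeasure ((F ^^ k) \<mu>) ({Some y} \<inter> {None})
        + emeasure (restr (Suc n) (Neg E) ((F ^^ k) \<mu>)) {Some y})"
      unfolding \<nu>_def timed.simps F_def
      by (intro emeasure_sem_While sem_in_Meas \<mu> singleton_state y)
    then show ?thesis by (simp del: restr.simps)
  qed
  show "time_le n z (sem (Suc n) (timed n (While E B)) \<mu>) (ennreal q * C) Q"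
    unfolding time_le_def \<nu>_def[symmetric]
  proof
    fix x assume x: "x \<in> vecs n"
    let ?w = "event_weight (Neg E) x"
    have w: "0 \<le> ?w" by (rule event_weight_bounds(1)[OF wf'])
    have c1: "0 \<le> 1 / (1 - c)" using c by simp
    have "time_weight z \<nu> x = (\<Sum>k. time_weight z (restr (Suc n) (Neg E) ((F ^^ k) \<mu>)) x)"
      unfolding time_weight_def \<nu>[OF snoc_in_vecs[OF x]] ennreal_suminf_cmult[symmetric]
      by (rule suminf_swap_ennreal)
    also have "\<dots> = (\<Sum>k. ennreal ?w * time_weight z ((F ^^ k) \<mu>) x)"
      by (intro suminf_cong time_weight_restr[OF Fk time_le_finite[OF Fk z Ck R inv] wf' x])
    also have "\<dots> \<le> (\<Sum>k. ennreal c' ^ k * (ennreal ?w * C * ennreal (coeff_at (R, \<gamma>) x)))"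
    proof (intro suminf_le summableI)
      fix k
      have "ennreal ?w * time_weight z ((F ^^ k) \<mu>) x \<le> ennreal ?w * (ennreal c' ^ k * C * ennreal (coeff_at (R, \<gamma>) x))"
        using inv x unfolding time_le_def by (intro mult_left_mono) auto
      then show "ennreal ?w * time_weight z ((F ^^ k) \<mu>) x \<le> ennreal c' ^ k * (ennreal ?w * C * ennreal (coeff_at (R, \<gamma>) x))"
        by (simp only: mult_ac)
    qed
    also have "\<dots> = ennreal (1 / (1 - c')) * (ennreal ?w * C * ennreal (coeff_at (R, \<gamma>) x))"
      by (simp only: ennreal_suminf_multc suminf_geometric_ennreal[OF c'])
    \<comment> \<open>The only loss in the summation over the passes: the slack \<open>q\<close> of
      the loop is spent here.\<close>
    also have "\<dots> \<le> ennreal (q / (1 - c)) * (ennreal ?w * C * ennreal (coeff_at (R, \<gamma>) x))"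
      using q(3) by (intro mult_right_mono ennreal_leI) (auto simp: c'_def)
    also have "ennreal (q / (1 - c)) = ennreal q * ennreal (1 / (1 - c))"
      using c by (simp add: ennreal_mult''[symmetric])
    also have "ennreal q * ennreal (1 / (1 - c)) * (ennreal ?w * C * ennreal (coeff_at (R, \<gamma>) x))
        = ennreal q * C * ennreal (?w * ((1 / (1 - c)) * coeff_at (R, \<gamma>) x))"
      unfolding ennreal_mult'[OF w] ennreal_mult'[OF c1] by (simp only: mult_ac)
    also have "?w * ((1 / (1 - c)) * coeff_at (R, \<gamma>) x) = coeff_at Q x"
    proof -
      have "is_egd n (scale_tensor (1 / (1 - c)) R, \<gamma>)" using R c by (intro is_egd_scale_tensor) auto
      from coeff_at_geo_event[OF this wf'] show ?thesis
        using coeff_at_scale_tensor[OF R, of x "1 / (1 - c)"] x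
        unfolding Q by (simp only: in_vecs_iff)
    qed
    finally show "time_weight z \<nu> x \<le> ennreal q * C * ennreal (coeff_at Q x)" .
  qed
qed

lemma slowdown_le_update:
  assumes k: "k < n" and z: "z \<le> q"
    and s: "sem (Suc n) P = update_sem (Suc n) (\<lambda>x. x[k := g (x ! k)])" and t: "timed n P = Seq P (Incr n 1)"
    and AB: "\<And>x. length x = n \<Longrightarrow>
      (\<Sum>j. if g j = x ! k then ennreal (coeff_at A (x[k := j])) else 0) \<le> ennreal (coeff_at B x)"
  shows "slowdown_le n P A B q z"
  unfolding slowdown_le_def t sem.simps(2) s
  using time_le_tick[OF update_sem_in_Meas time_le_update[OF _ _ k AB] z] by blast

text \<open>\<open>q\<close> varies in the induction because compound programs demand smaller slacks
  of their parts. Each part contributes a threshold for \<open>z\<close>, and the smaller of two is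
  taken.\<close>

lemma ex_slowdown:
  assumes "wf_prog n P" "is_egd n A" "is_egd n B" "geo_sem n P A B" "1 < q"
  shows "\<exists>z0>1. \<forall>z. 1 < z \<longrightarrow> z \<le> z0 \<longrightarrow> slowdown_le n P A B q z"
  using assms
proof (induction P arbitrary: A B q)
  case Skip
  then have "B = A" by (cases A; cases B) simp
  \<comment> \<open>For each simple statement the threshold is \<open>q\<close> itself, since its
    single tick costs the factor \<open>z\<close>.\<close>
  then have "slowdown_le n Skip A B q z" if "z \<le> q" for z
    unfolding slowdown_le_def using time_le_tick[OF _ _ that] by auto
  then show ?case using Skip.prems by blast
next
  case (Seq P1 P2)
  obtain R where R: "is_egd n R" "geo_sem n P1 A R" "geo_sem n P2 R B"
    using Seq.prems(4) by (cases A; cases B) auto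
  \<comment> \<open>Prices multiply along a sequence, so each half may spend
    \<open>sqrt q\<close>.\<close>
  have q: "1 < sqrt q" "ennreal (sqrt q) * (ennreal (sqrt q) * C) = ennreal q * C" for C
    using Seq.prems(5) by (auto simp: mult.assoc[symmetric] ennreal_mult''[symmetric])
  obtain z1 where z1: "z1 > 1" "\<And>z. 1 < z \<Longrightarrow> z \<le> z1 \<Longrightarrow> slowdown_le n P1 A R (sqrt q) z"
    using Seq.IH(1)[OF _ _ _ R(2) q(1)] Seq.prems R by auto
  obtain z2 where z2: "z2 > 1" "\<And>z. 1 < z \<Longrightarrow> z \<le> z2 \<Longrightarrow> slowdown_le n P2 R B (sqrt q) z"
    using Seq.IH(2)[OF _ _ _ R(3) q(1)] Seq.prems R by auto
  have "slowdown_le n (Seq P1 P2) A B q z" if "1 < z" "z \<le> min z1 z2" for z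
    unfolding slowdown_le_def timed.simps sem.simps
  proof (intro ballI allI impI)
    fix \<mu> C assume \<mu>: "\<mu> \<in> Meas (Suc n)" and C: "C < (\<top>::ennreal)" and le: "time_le n z \<mu> C A"
    have Cq: "ennreal (sqrt q) * C < \<top>" using C by (simp add: ennreal_mult_less_top)
    have s: "slowdown_le n P1 A R (sqrt q) z" "slowdown_le n P2 R B (sqrt q) z"
      using z1(2) z2(2) that by simp_all
    have "time_le n z (sem (Suc n) (timed n P2) (sem (Suc n) (timed n P1) \<mu>)) (ennreal (sqrt q) * (ennreal (sqrt q) * C)) B"
      by (rule slowdown_leD[OF s(2) sem_in_Meas[OF \<mu>] Cq slowdown_leD[OF s(1) \<mu> C le]])
    then show "time_le n z (sem (Suc n) (timed n P2) (sem (Suc n) (timed n P1) \<mu>)) (ennreal q * C) B"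
      by (simp only: q(2))
  qed
  then show ?case using z1(1) z2(1) by (intro exI[of _ "min z1 z2"]) auto
next
  case (SetZero k)
  obtain P \<alpha> Q \<beta> where AB: "A = (P, \<alpha>)" "B = (Q, \<beta>)" by (metis surj_pair)
  have k: "k < n" using SetZero.prems by simp
  note c = coeff_at_SetZero[OF SetZero.prems(2)[unfolded AB] SetZero.prems(4)[unfolded AB] _ k]
  have "slowdown_le n (SetZero k) A B q z" if "z \<le> q" for z
    unfolding AB by (rule slowdown_le_update[where g = "\<lambda>_. 0", OF k that _ _ c]) simp_all
  then show ?case using SetZero.prems(5) by blast
next
  case (Incr k a)
  obtain P \<alpha> Q \<beta> where AB: "A = (P, \<alpha>)" "B = (Q, \<beta>)" by (metis surj_pair)
  have k: "k < n" using Incr.prems by simp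
  note c = coeff_at_Incr[OF Incr.prems(2)[unfolded AB] Incr.prems(4)[unfolded AB] _ k]
  have "slowdown_le n (Incr k a) A B q z" if "z \<le> q" for z
    unfolding AB by (rule slowdown_le_update[where g = "\<lambda>j. j + a", OF k that _ _ c]) simp_all
  then show ?case using Incr.prems(5) by blast
next
  case (Decr k)
  obtain P \<alpha> Q \<beta> where AB: "A = (P, \<alpha>)" "B = (Q, \<beta>)" by (metis surj_pair)
  have k: "k < n" using Decr.prems by simp
  note c = coeff_at_Decr[OF Decr.prems(2)[unfolded AB] Decr.prems(4)[unfolded AB] _ k]
  have "slowdown_le n (Decr k) A B q z" if "z \<le> q" for z
    unfolding AB by (rule slowdown_le_update[where g = "\<lambda>j. j - 1", OF k that _ _ c]) simp_all
  then show ?case using Decr.prems(5) by blast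
next
  case (If E P1 P2)
  obtain R S where RS: "is_egd n R" "is_egd n S" "geo_sem n P1 (geo_event E A) R"
     "geo_sem n P2 (geo_event (Neg E) A) S" "egd_join R S B"
    using If.prems(4) by (cases A; cases B) (auto simp del: geo_event.simps)
  have wf: "wf_event n E" "wf_event n (Neg E)" "wf_prog n P1" "wf_prog n P2" using If.prems by auto
  have ev: "is_egd n (geo_event E A)" "is_egd n (geo_event (Neg E) A)"
    using coeff_at_geo_event[OF If.prems(2) wf(1)] coeff_at_geo_event[OF If.prems(2) wf(2)] by blast+
  obtain z1 where z1: "z1 > 1" "\<And>z. 1 < z \<Longrightarrow> z \<le> z1 \<Longrightarrow> slowdown_le n P1 (geo_event E A) R q z"
    using If.IH(1)[OF wf(3) ev(1) RS(1,3) If.prems(5)] by blast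
  obtain z2 where z2: "z2 > 1" "\<And>z. 1 < z \<Longrightarrow> z \<le> z2 \<Longrightarrow> slowdown_le n P2 (geo_event (Neg E) A) S q z"
    using If.IH(2)[OF wf(4) ev(2) RS(2,4) If.prems(5)] by blast
  have "slowdown_le n (If E P1 P2) A B q z" if "1 < z" "z \<le> min z1 z2" for z
    using that z1(2) z2(2)
    by (intro slowdown_le_If[OF If.prems(2) RS(1,2,5) wf(1)]) auto
  then show ?case using z1(1) z2(1) by (intro exI[of _ "min z1 z2"]) auto
next
  case (While E B')
  obtain c R \<gamma> S where W: "0 \<le> c" "c < 1" "is_egd n (R, \<gamma>)" "is_egd n S" "egd_le A (R, \<gamma>)"
     "geo_sem n B' (geo_event E (R, \<gamma>)) S" "egd_le S (scale_tensor c R, \<gamma>)"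
     "geo_event (Neg E) (scale_tensor (1 / (1 - c)) R, \<gamma>) = B"
    using While.prems(4) by (cases A; cases B) (auto simp del: geo_event.simps)
  have wf: "wf_event n E" "wf_prog n B'" using While.prems by auto
  have ev: "is_egd n (geo_event E (R, \<gamma>))" using coeff_at_geo_event[OF W(3) wf(1)] by blast
  \<comment> \<open>The target for \<open>1 - c * q'\<close>: its reciprocal is exactly
    \<open>q / (1 - c)\<close>. As \<open>q > 1\<close>, it lies strictly below
    \<open>1 - c\<close>, which leaves room for some \<open>q' > 1\<close>.\<close>
  define r where "r = (1 - c) / q"
  have r: "0 < r" "r < 1 - c" "q * r = 1 - c"
    using W(1,2) While.prems(5) by (auto simp: r_def divide_less_eq)
  \<comment> \<open>Solving \<open>1 - c * q' = r\<close> for \<open>q'\<close> would divide by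
    \<open>c\<close>, which may be 0. Adding the gap \<open>1 - r - c\<close> to 1 is enough because
    \<open>c < 1\<close>.\<close>
  define q' where "q' = 1 + (1 - r - c)"
  have "c * (1 - r - c) \<le> 1 * (1 - r - c)" using W(2) r by (intro mult_right_mono) auto
  then have "c * q' \<le> c + (1 - r - c)" unfolding q'_def distrib_left mult_1_right mult_1_left
    by (rule add_left_mono)
  then have rq: "r \<le> 1 - c * q'" by simp
  then have "1 / (1 - c * q') \<le> 1 / r" using r by (intro divide_left_mono) auto
  also have "1 / r = q / (1 - c)" using r W(2) While.prems(5) by (simp add: r_def)
  finally have q': "1 < q'" "c * q' < 1" "1 / (1 - c * q') \<le> q / (1 - c)"
    using rq r by (auto simp: q'_def)
  obtain z0 where "z0 > 1" "\<And>z. 1 < z \<Longrightarrow> z \<le> z0 \<Longrightarrow> slowdown_le n B' (geo_event E (R, \<gamma>)) S q' z"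
    using While.IH[OF wf(2) ev W(4,6) q'(1)] by blast
  moreover have "slowdown_le n (While E B') A B q z"
    if "1 < z" "slowdown_le n B' (geo_event E (R, \<gamma>)) S q' z" for z
    using slowdown_le_While[OF While.prems(2) W(3,4,1,2) wf(1) that(1) W(5,7) _ q'(2,3) that(2) W(8)] q'(1) by simp
  ultimately show ?case by blast
next
  case Fail
  have "slowdown_le n Fail A B q z" if "z \<le> q" for z
    unfolding slowdown_le_def
  proof (intro ballI allI impI)
    fix \<mu> C assume \<mu>: "\<mu> \<in> Meas (Suc n)"
    let ?f = "\<lambda>S. emeasure \<mu> (states (Suc n)) * indicator S None"
    have "is_mass (Suc n) ?f"
      unfolding is_mass_def by (auto simp: suminf_indicator)
    \<comment> \<open>All mass now sits on the failure state, where \<open>time_le\<close> does not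
      look; the following tick preserves this bound up to the factor \<open>q\<close>.\<close>
    then have "emeasure (sem (Suc n) Fail \<mu>) {Some y} = 0" if "y \<in> vecs (Suc n)" for y
      using emeasure_mk_meas[OF _ singleton_state[OF that], of ?f] by simp
    then have "time_le n z (sem (Suc n) Fail \<mu>) C B"
      by (simp add: time_le_def time_weight_def snoc_in_vecs del: sem.simps)
    then show "time_le n z (sem (Suc n) (timed n Fail) \<mu>) (ennreal q * C) B"
      using time_le_tick[OF sem_in_Meas[OF \<mu>, of Fail] _ that] by simp
  qed
  then show ?case using Fail.prems by blast
qed

section \<open>The distribution of the running time\<close>

text \<open>Chernoff's argument: the mass at clock value \<open>t\<close> is at most
  \<open>z\<close> to the power \<open>-t\<close> times the total of the generating
  functions.\<close>

lemma emeasure_time_le: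
  assumes \<nu>: "\<nu> \<in> Meas (Suc n)" and z: "1 < z" and le: "time_le n z \<nu> C B"
  shows "emeasure \<nu> (Some ` {y \<in> vecs (Suc n). y ! n = t}) \<le> C * egd_mass n B * ennreal ((1 / z) ^ t)"
proof -
  have zt: "ennreal ((1 / z) ^ t) * ennreal z ^ t = 1"
    using z by (simp add: ennreal_power ennreal_mult''[symmetric] power_mult_distrib[symmetric])
  let ?S = "{y \<in> vecs (Suc n). y ! n = t}"
  have "emeasure \<nu> (Some ` ?S) = (\<integral>\<^sup>+y. emeasure \<nu> {Some y} * indicator ?S y \<partial>count_space (vecs (Suc n)))"
    by (rule emeasure_Some_vecs[OF \<nu>]) auto
  also have "\<dots> = (\<integral>\<^sup>+x. (\<Sum>t'. emeasure \<nu> {Some (x @ [t'])} * indicator ?S (x @ [t'])) \<partial>count_space (vecs n))"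
    by (rule nn_integral_vecs_snoc)
  also have "\<dots> \<le> (\<integral>\<^sup>+x. (C * ennreal ((1 / z) ^ t)) * ennreal (coeff_at B x) \<partial>count_space (vecs n))"
  proof (rule nn_integral_mono)
    fix x assume "x \<in> space (count_space (vecs n))"
    then have x: "x \<in> vecs n" by simp
    have "(\<Sum>t'. emeasure \<nu> {Some (x @ [t'])} * indicator ?S (x @ [t'])) =
        (\<Sum>t'. if t' = t then emeasure \<nu> {Some (x @ [t'])} else 0)"
      using x by (intro suminf_cong) (auto simp: vecs_def indicator_def nth_append)
    also have "\<dots> = ennreal ((1 / z) ^ t) * (ennreal z ^ t * emeasure \<nu> {Some (x @ [t])})"
      by (simp only: suminf_indicator_ennreal mult.assoc[symmetric] zt mult_1_left)
    \<comment> \<open>One term of a series of nonnegative terms is at most its sum.\<close>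
    also have "\<dots> \<le> ennreal ((1 / z) ^ t) * time_weight z \<nu> x"
      unfolding time_weight_def
      using sum_le_suminf[of "\<lambda>t. ennreal z ^ t * emeasure \<nu> {Some (x @ [t])}" "{t}"]
      by (intro mult_left_mono) auto
    also have "\<dots> \<le> ennreal ((1 / z) ^ t) * (C * ennreal (coeff_at B x))"
      using le x by (intro mult_left_mono) (auto simp: time_le_def)
    finally show "(\<Sum>t'. emeasure \<nu> {Some (x @ [t'])} * indicator ?S (x @ [t'])) \<le>
        (C * ennreal ((1 / z) ^ t)) * ennreal (coeff_at B x)" by (simp only: mult_ac)
  qed
  also have "\<dots> = C * egd_mass n B * ennreal ((1 / z) ^ t)"
    unfolding egd_mass_def by (subst nn_integral_cmult) (simp_all only: mult_ac borel_measurable_count_space)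
  finally show ?thesis .
qed

lemma emeasure_sem_proper:
  assumes "S \<subseteq> vecs n"
  shows "emeasure (sem_proper n P M) S =
    emeasure (sem n P (distr M (count_space (states n)) Some)) (Some ` S)"
proof -
  let ?\<nu> = "sem n P (distr M (count_space (states n)) Some)"
  have "?\<nu> \<in> Meas n" by (intro sem_in_Meas) (simp add: Meas_def)
  note sets = MeasD(1)[OF this]
  show ?thesis
  proof (rule emeasure_measure_of[OF sem_proper_def])
    show "countably_additive (sets (sem_proper n P M)) (\<lambda>S. emeasure ?\<nu> (Some ` S))"
    proof (rule countably_additiveI)
      fix A :: "nat \<Rightarrow> nat list set"
      assume A: "range A \<subseteq> sets (sem_proper n P M)" "disjoint_family A"
      have "(\<Sum>i. emeasure ?\<nu> (Some ` A i)) = emeasure ?\<nu> (\<Union>i. Some ` A i)"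
      proof (rule suminf_emeasure)
        show "range (\<lambda>i. Some ` A i) \<subseteq> sets ?\<nu>"
          using A(1) unfolding sets by (fastforce simp: sem_proper_def states_def)
        show "disjoint_family (\<lambda>i. Some ` A i)"
          using A(2) by (simp add: disjoint_family_on_def image_Int[symmetric])
      qed
      then show "(\<Sum>i. emeasure ?\<nu> (Some ` A i)) = emeasure ?\<nu> (Some ` (\<Union>i. A i))"
        by (simp add: image_UN)
    qed
  qed (use assms in \<open>auto simp: sem_proper_def positive_def\<close>)
qed

lemma emeasure_EGD_singleton:
  assumes "x \<in> vecs n"
  shows "emeasure (EGD n A) {x} = ennreal (coeff_at A x)"
  using assms unfolding EGD_def point_measure_def by (subst emeasure_density) simp_all

lemma sets_EGD [simp]: "sets (EGD n A) = Pow (vecs n)"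
  and space_EGD [simp]: "space (EGD n A) = vecs n"
  by (simp_all add: EGD_def sets_point_measure space_point_measure)

text \<open>The argument of \<open>sem\<close> that appears when \<open>running_time\<close> and
  \<open>sem_proper\<close> are unfolded.\<close>

definition initial_meas :: "nat \<Rightarrow> egd \<Rightarrow> nat list option measure" where
  "initial_meas n A = distr
     (distr (EGD n A \<Otimes>\<^sub>M return (count_space UNIV) 0) (count_space (vecs (n + 1))) (\<lambda>(x, t). x @ [t]))
     (count_space (states (n + 1))) Some"

lemma initial_meas_in_Meas: "initial_meas n A \<in> Meas (Suc n)"
  by (simp add: initial_meas_def Meas_def)

lemma emeasure_initial_meas:
  assumes x: "x \<in> vecs n"
  shows "emeasure (initial_meas n A) {Some (x @ [t])} = (if t = 0 then ennreal (coeff_at A x) else 0)"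
proof -
  let ?R = "return (count_space UNIV) (0::nat)" and ?f = "\<lambda>(x, t::nat). x @ [t]"
  let ?E = "EGD n A \<Otimes>\<^sub>M ?R"
  interpret R: prob_space ?R by (rule prob_space_return) simp
  \<comment> \<open>Both factors are discrete and countable, so the product is discrete and
    appending the clock is measurable.\<close>
  have "sets ?E = sets (count_space (vecs n) \<Otimes>\<^sub>M count_space (UNIV :: nat set))"
    by (intro sets_pair_measure_cong) simp_all
  also have "\<dots> = sets (count_space (vecs n \<times> UNIV))"
    by (subst pair_measure_countable) (simp_all add: countableI_type)
  finally have "?E \<rightarrow>\<^sub>M N = count_space (vecs n \<times> UNIV) \<rightarrow>\<^sub>M N" for N :: "nat list measure"
    by (rule measurable_cong_sets) simp
  then have f: "?f \<in> ?E \<rightarrow>\<^sub>M count_space (vecs (n + 1))"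
    by (auto simp: vecs_def)
  have y: "x @ [t] \<in> vecs (n + 1)" using x by (simp add: vecs_def)
  have "emeasure (initial_meas n A) {Some (x @ [t])} =
      emeasure (distr ?E (count_space (vecs (n + 1))) ?f) (Some -` {Some (x @ [t])} \<inter> vecs (n + 1))"
    unfolding initial_meas_def using y by (subst emeasure_distr) (auto simp: states_def)
  also have "Some -` {Some (x @ [t])} \<inter> vecs (n + 1) = {x @ [t]}" using y by auto
  also have "emeasure (distr ?E (count_space (vecs (n + 1))) ?f) {x @ [t]} =
      emeasure ?E (?f -` {x @ [t]} \<inter> space ?E)"
    using y by (intro emeasure_distr[OF f]) simp
  also have "?f -` {x @ [t]} \<inter> space ?E = {x} \<times> {t}"
    using x by (auto simp: space_pair_measure)
  also have "emeasure ?E ({x} \<times> {t}) = emeasure (EGD n A) {x} * emeasure ?R {t}"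
    using x by (intro R.emeasure_pair_measure_Times) auto
  also have "\<dots> = (if t = 0 then ennreal (coeff_at A x) else 0)"
    using x by (simp add: emeasure_EGD_singleton)
  finally show ?thesis .
qed

text \<open>The clock starts at 0, so only the weight \<open>z ^ 0 = 1\<close> occurs.\<close>

lemma time_le_initial_meas: "time_le n z (initial_meas n A) 1 A"
proof -
  have "time_weight z (initial_meas n A) x = (\<Sum>t. if t = 0 then ennreal z ^ t * ennreal (coeff_at A x) else 0)"
    if "x \<in> vecs n" for x
    unfolding time_weight_def emeasure_initial_meas[OF that] by (intro suminf_cong) simp
  then show ?thesis by (simp add: time_le_def suminf_indicator_ennreal)
qed

lemma emeasure_running_time:
  "emeasure (running_time n P (EGD n A)) {t} =
    emeasure (sem (Suc n) (timed n P) (initial_meas n A)) (Some ` {y \<in> vecs (Suc n). y ! n = t})"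
proof -
  have s: "sets (sem_proper m Q M) = Pow (vecs m)" "space (sem_proper m Q M) = vecs m" for m Q M
    by (simp_all add: sem_proper_def)
  have m: "f \<in> sem_proper m Q M \<rightarrow>\<^sub>M count_space UNIV" for m Q M and f :: "nat list \<Rightarrow> nat"
    by (auto simp: measurable_def s)
  show ?thesis
    unfolding running_time_def
    by (subst emeasure_distr[OF m], simp, subst emeasure_sem_proper)
      (auto simp: s initial_meas_def vimage_def Int_def conj_commute)
qed

text \<open>Differentiating the power series termwise and multiplying by \<open>x\<close> raises the
  power of \<open>t\<close> by one. Differentiation needs convergence on the whole interval below 1,
  hence the arbitrary \<open>x\<close> in the induction.\<close>

lemma summable_power_mult_geometric:
  "\<bar>x\<bar> < 1 \<Longrightarrow> summable (\<lambda>t. real t ^ k * x ^ t)"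
proof (induction k arbitrary: x)
  case 0
  then show ?case by (simp add: summable_geometric)
next
  case (Suc k)
  have "summable (\<lambda>t. diffs (\<lambda>t. real t ^ k) t * x ^ t)"
    using Suc by (intro termdiff_converges[where K = 1]) auto
  then have "summable (\<lambda>t. diffs (\<lambda>t. real t ^ k) t * x ^ t * x)"
    by (rule summable_mult2)
  then have "summable (\<lambda>t. real (Suc t) ^ Suc k * x ^ Suc t)"
    by (simp add: diffs_def mult_ac)
  then show ?case by (subst (asm) summable_Suc_iff)
qed

lemma emeasure_nat_eq:
  fixes M :: "nat measure"
  assumes "sets M = UNIV"
  shows "emeasure M S = (\<integral>\<^sup>+t. emeasure M {t} \<partial>count_space S)"
  using assms by (intro emeasure_countable_singleton) auto

lemma geometric_tail_EGD1:
  assumes M: "sets M = (UNIV :: nat set set)" and K: "0 \<le> K" and \<tau>: "0 \<le> \<tau>" "\<tau> < 1"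
    and le: "\<And>t. emeasure M {t} \<le> ennreal (K * \<tau> ^ t)"
  shows "\<exists>U \<tau>. is_egd 1 (U, [\<tau>]) \<and> M \<preceq> EGD1 U \<tau>" "moment k M < \<infinity>"
proof -
  \<comment> \<open>With size 1 the only cell is already the border, so decay starts at once and the
    mass at \<open>t\<close> is \<open>K * \<tau> ^ t\<close>.\<close>
  define U where "U = mk_tensor [1] (\<lambda>_. K)"
  have U: "is_egd 1 (U, [\<tau>])" unfolding U_def using K \<tau> by (intro is_egd_mk_tensor) auto
  have sets: "sets (EGD1 U \<tau>) = UNIV" by (simp add: EGD1_def)
  have "emeasure (EGD1 U \<tau>) {t} = ennreal (K * \<tau> ^ t)" for t
  proof -
    have m: "hd \<in> EGD 1 (U, [\<tau>]) \<rightarrow>\<^sub>M count_space UNIV" by (auto simp: measurable_def)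
    have "emeasure (EGD1 U \<tau>) {t} = emeasure (EGD 1 (U, [\<tau>])) (hd -` {t} \<inter> vecs 1)"
      unfolding EGD1_def by (subst emeasure_distr[OF m]) simp_all
    also have "hd -` {t} \<inter> vecs 1 = {[t]}" by (auto simp: vecs_def length_Suc_conv)
    also have "emeasure (EGD 1 (U, [\<tau>])) {[t]} = ennreal (coeff_at (U, [\<tau>]) [t])"
      by (rule emeasure_EGD_singleton) (simp add: vecs_def)
    also have "coeff_at (U, [\<tau>]) [t] = K * \<tau> ^ t"
      unfolding U_def by (subst coeff_at_mk_tensor[where n = 1]) (auto simp: excess_def)
    finally show ?thesis .
  qed
  then have "emeasure M S \<le> emeasure (EGD1 U \<tau>) S" for S
    using le by (simp add: emeasure_nat_eq[OF M, of S] emeasure_nat_eq[OF sets, of S] nn_integral_mono)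
  then have "M \<preceq> EGD1 U \<tau>" by (simp add: meas_le_def M sets)
  then show "\<exists>U \<tau>. is_egd 1 (U, [\<tau>]) \<and> M \<preceq> EGD1 U \<tau>" using U by blast
  have "moment k M \<le> (\<Sum>t. ennreal (K * (real t ^ k * \<tau> ^ t)))"
    unfolding moment_def
  proof (intro suminf_le summableI)
    fix t
    have "of_nat (t ^ k) = ennreal (real t ^ k)"
      by (subst ennreal_of_nat_eq_real_of_nat) simp
    then have "of_nat (t ^ k) * emeasure M {t} \<le> ennreal (real t ^ k) * ennreal (K * \<tau> ^ t)"
      using le by (intro mult_mono) auto
    then show "of_nat (t ^ k) * emeasure M {t} \<le> ennreal (K * (real t ^ k * \<tau> ^ t))"
      using K \<tau> by (simp add: ennreal_mult'[symmetric] mult_ac)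
  qed
  also have "\<dots> < \<infinity>"
    using K \<tau> summable_mult[OF summable_power_mult_geometric[of \<tau> k], of K]
    by (subst suminf_ennreal2) auto
  finally show "moment k M < \<infinity>" .
qed

theorem theorem4p16:
  fixes n :: nat and prg :: prog and P Q :: tensor and \<alpha> \<beta> :: "real list"
  assumes "wf_prog n prg"
    and "is_egd n (P, \<alpha>)"
    and "is_egd n (Q, \<beta>)"
    and "geo_sem n prg (P, \<alpha>) (Q, \<beta>)"
  shows "(\<exists>U \<tau>. is_egd 1 (U, [\<tau>]) \<and> running_time n prg (EGD n (P, \<alpha>)) \<preceq> EGD1 U \<tau>) \<and>
         (\<forall>k. moment k (running_time n prg (EGD n (P, \<alpha>))) < \<infinity>)"
proof -
  let ?A = "(P, \<alpha>)" and ?B = "(Q, \<beta>)"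
  \<comment> \<open>Any slack above 1 would do; 2 is arbitrary.\<close>
  obtain z where z: "1 < z" "slowdown_le n prg ?A ?B 2 z"
    using ex_slowdown[OF assms, of 2] by auto
  define \<nu> where "\<nu> = sem (Suc n) (timed n prg) (initial_meas n ?A)"
  have \<nu>: "\<nu> \<in> Meas (Suc n)" unfolding \<nu>_def by (intro sem_in_Meas initial_meas_in_Meas)
  have "time_le n z \<nu> (ennreal 2 * 1) ?B"
    unfolding \<nu>_def by (intro slowdown_leD[OF z(2)] initial_meas_in_Meas time_le_initial_meas) simp
  note tail = emeasure_time_le[OF \<nu> z(1) this]
  \<comment> \<open>The total weighted mass, finite because EGDs have finite mass. It becomes the
    tensor entry of the final EGD, whose rate is \<open>1 / z\<close>.\<close>
  define K where "K = enn2real (ennreal 2 * 1 * egd_mass n ?B)"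
  have K: "ennreal K = ennreal 2 * 1 * egd_mass n ?B"
    unfolding K_def using egd_mass_finite[OF assms(3)]
    by (intro ennreal_enn2real) (simp add: ennreal_mult_less_top)
  have K0: "0 \<le> K" by (simp add: K_def)
  have "emeasure (running_time n prg (EGD n ?A)) {t} \<le> ennreal (K * (1 / z) ^ t)" for t
    using tail[of t] unfolding emeasure_running_time \<nu>_def[symmetric] K[symmetric] ennreal_mult'[OF K0] .
  moreover have "sets (running_time n prg (EGD n ?A)) = UNIV"
    by (simp add: running_time_def)
  ultimately show ?thesis
    using geometric_tail_EGD1[OF _ K0, of "running_time n prg (EGD n ?A)" "1 / z"] z(1) by auto
qed

end
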